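(* Let $\tau>0$, and assume that the mobility function satisfies $\mathcal{M}(x)\ge \mathcal{M}_0>0$ for all $x\in[-1,1]$. Let $\phi^{n},\phi^{n-1}\in\mathcal{V}_{\mathrm{per}}$ be given with $\|\phi^{k}\|_{\infty}<1$ for $k=n,n-1$, and $|\overline{\phi^{n}}|=|\overline{\phi^{n-1}}|<1$. Then there exists a unique solution $\phi^{n+1}\in\mathcal{V}_{\mathrm{per}}$ of the numerical scheme $$\frac{\phi^{n+1}-\phi^{n}}{\tau}=\nabla_h\cdot\big(\breve{\mathcal{M}}^{n+\frac12}\nabla_h\mu^{n+\frac12}\big),\qquad \mu^{n+\frac12}=\mu_h[\phi^{n+1},\phi^{n},\phi^{n-1}],$$ such that $\phi^{n+1}-\overline{\phi^{n}}\in\mathring{\mathcal{V}}_{\mathrm{per}}$ and $\|\phi^{n+1}\|_{\infty}<1$.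
   Context: Grid: $\Omega=(0,L)^3$, $L>0$, $h=L/N$ with $N$ a positive integer. $\mathcal{V}_{\mathrm{per}}$ is the space of real grid functions $u=(u_{i,j,k})_{i,j,k\in\mathbb{Z}}$ on the cell centers $(p_i,p_j,p_k)$, $p_i=(i-\frac12)h$, that are $N$-periodic in each index. $\langle u,\xi\rangle_\Omega=h^3\sum_{i,j,k=1}^N u_{i,j,k}\xi_{i,j,k}$, $\|u\|_\infty=\max_{1\le i,j,k\le N}|u_{i,j,k}|$, $\overline{u}=|\Omega|^{-1}\langle u,1\rangle_\Omega$, and $\mathring{\mathcal{V}}_{\mathrm{per}}=\{u\in\mathcal{V}_{\mathrm{per}}:\overline u=0\}$. Center-to-face operators: $A_xu_{i+\frac12,j,k}=\frac12(u_{i+1,j,k}+u_{i,j,k})$, $D_xu_{i+\frac12,j,k}=\frac1h(u_{i+1,j,k}-u_{i,j,k})$; face-to-center difference: $d_xw_{i,j,k}=\frac1h(w_{i+\frac12,j,k}-w_{i-\frac12,j,k})$; similarly in $y,z$. $\nabla_hu=(D_xu,D_yu,D_zu)$, $\nabla_h\cdot\vec w=d_xw^x+d_yw^y+d_zw^z$, $\Delta_hu=\nabla_h\cdot\nabla_hu$; for a face-centered scalar function $g$, $\nabla_h\cdot(g\nabla_hu)=d_x(gD_xu)+d_y(gD_yu)+d_z(gD_zu)$. $A_h$ denotes averaging to face-centered points ($A_x$ on $x$-faces, $A_y$ on $y$-faces, $A_z$ on $z$-faces). $(-\Delta_h)^{-1}$ is the inverse of $-\Delta_h$ on $\mathring{\mathcal{V}}_{\mathrm{per}}$.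 Parameters: $\theta_0>0$, $\varepsilon>0$, $\sigma\ge0$; $\mathcal{M}$ is the mobility function on $[-1,1]$. Scheme: $G(x)=x\ln x$ (with $G(0)=0$), and for grid functions $u,v,w$ (values of $u,v$ in $(-1,1)$) $$\begin{aligned}\mu_h[u,v,w]={}&\frac{G(1+u)-G(1+v)}{u-v}+\frac{G(1-u)-G(1-v)}{u-v}-\theta_0\Big(\tfrac32v-\tfrac12w\Big)-\varepsilon^2\Delta_h\Big(\tfrac34u+\tfrac14w\Big)\\&+\sigma(-\Delta_h)^{-1}\Big(\tfrac{u+v}2-\overline{\tfrac{u+v}2}\Big)+\tau\big(\ln(1+u)-\ln(1+v)-\ln(1-u)+\ln(1-v)\big),\end{aligned}$$ where the difference quotients are understood pointwise, and at points with $u=v$ as their limits $G'(1+v)$ and $-G'(1-v)$, with $G'(x)=\ln x+1$. The face-centered discrete mobility is $$\breve{\mathcal{M}}^{n+\frac12}=\Big(\big(A_h(\tfrac32\mathcal{M}(\phi^n)-\tfrac12\mathcal{M}(\phi^{n-1}))\big)^2+\tau^6\Big)^{1/2}.$$ *)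

theory Defs
  imports Complex_Main
begin

text \<open>
  A cell-centred grid function assigns to \<open>(i, j, k)\<close> its value at \<open>(p\<^sub>i, p\<^sub>j, p\<^sub>k)\<close>.
  A face-centred function is a triple of its values on the x-, y- and z-faces; the first component
  at \<open>(i, j, k)\<close> is the value at the x-face \<open>(i + 1/2, j, k)\<close>, the second one the value at the
  y-face \<open>(i, j + 1/2, k)\<close>, and the third one the value at the z-face \<open>(i, j, k + 1/2)\<close>.
\<close>

type_synonym grid = "int \<Rightarrow> int \<Rightarrow> int \<Rightarrow> real"
type_synonym face = "grid \<times> grid \<times> grid"

definition spacing :: "real \<Rightarrow> nat \<Rightarrow> real" where
  "spacing L N = L / real N"

definition V_per :: "nat \<Rightarrow> grid set" where
  "V_per N = {u. \<forall>i j k. u (i + int N) j k = u i j k \<and> u i (j + int N) k = u i j k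
                       \<and> u i j (k + int N) = u i j k}"

definition inner_grid :: "real \<Rightarrow> nat \<Rightarrow> grid \<Rightarrow> grid \<Rightarrow> real" where
  "inner_grid L N u \<xi> = spacing L N ^ 3 *
     (\<Sum>i\<in>{1..int N}. \<Sum>j\<in>{1..int N}. \<Sum>k\<in>{1..int N}. u i j k * \<xi> i j k)"

definition norm_inf :: "nat \<Rightarrow> grid \<Rightarrow> real" where
  "norm_inf N u = Max ((\<lambda>(i, j, k). \<bar>u i j k\<bar>) ` ({1..int N} \<times> {1..int N} \<times> {1..int N}))"

definition mean :: "real \<Rightarrow> nat \<Rightarrow> grid \<Rightarrow> real" where
  "mean L N u = inner_grid L N u (\<lambda>i j k. 1) / L ^ 3"

definition V0_per :: "real \<Rightarrow> nat \<Rightarrow> grid set" where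
  "V0_per L N = {u \<in> V_per N. mean L N u = 0}"

definition avg_face :: "grid \<Rightarrow> face" where
  "avg_face u =
    ((\<lambda>i j k. (u (i + 1) j k + u i j k) / 2),
     (\<lambda>i j k. (u i (j + 1) k + u i j k) / 2),
     (\<lambda>i j k. (u i j (k + 1) + u i j k) / 2))"

definition grad :: "real \<Rightarrow> grid \<Rightarrow> face" where
  "grad h u =
    ((\<lambda>i j k. (u (i + 1) j k - u i j k) / h),
     (\<lambda>i j k. (u i (j + 1) k - u i j k) / h),
     (\<lambda>i j k. (u i j (k + 1) - u i j k) / h))"

definition divergence :: "real \<Rightarrow> face \<Rightarrow> grid" where
  "divergence h w = (case w of (wx, wy, wz) \<Rightarrow> \<lambda>i j k.
     (wx i j k - wx (i - 1) j k) / h +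
     (wy i j k - wy i (j - 1) k) / h +
     (wz i j k - wz i j (k - 1)) / h)"

definition face_map :: "(real \<Rightarrow> real) \<Rightarrow> face \<Rightarrow> face" where
  "face_map f g = (case g of (gx, gy, gz) \<Rightarrow>
     ((\<lambda>i j k. f (gx i j k)), (\<lambda>i j k. f (gy i j k)), (\<lambda>i j k. f (gz i j k))))"

definition face_times :: "face \<Rightarrow> face \<Rightarrow> face" where
  "face_times g w = (case g of (gx, gy, gz) \<Rightarrow> case w of (wx, wy, wz) \<Rightarrow>
     ((\<lambda>i j k. gx i j k * wx i j k),
      (\<lambda>i j k. gy i j k * wy i j k),
      (\<lambda>i j k. gz i j k * wz i j k)))"

definition laplacian :: "real \<Rightarrow> grid \<Rightarrow> grid" where
  "laplacian h u = divergence h (grad h u)"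

text \<open>The inverse of the bijection \<open>- laplacian\<close> of \<open>V0_per L N\<close>; meaningful only for arguments
  in \<open>V0_per L N\<close>.\<close>

definition inv_neg_laplacian :: "real \<Rightarrow> nat \<Rightarrow> grid \<Rightarrow> grid" where
  "inv_neg_laplacian L N =
     inv_into (V0_per L N) (\<lambda>u i j k. - laplacian (spacing L N) u i j k)"

definition G :: "real \<Rightarrow> real" where
  "G x = (if x = 0 then 0 else x * ln x)"

definition G' :: "real \<Rightarrow> real" where
  "G' x = ln x + 1"

definition quot_plus :: "real \<Rightarrow> real \<Rightarrow> real" where
  "quot_plus a b = (if a = b then G' (1 + b) else (G (1 + a) - G (1 + b)) / (a - b))"

definition quot_minus :: "real \<Rightarrow> real \<Rightarrow> real" where
  "quot_minus a b = (if a = b then - G' (1 - b) else (G (1 - a) - G (1 - b)) / (a - b))"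

definition mu_h ::
  "real \<Rightarrow> nat \<Rightarrow> real \<Rightarrow> real \<Rightarrow> real \<Rightarrow> real \<Rightarrow> grid \<Rightarrow> grid \<Rightarrow> grid \<Rightarrow> grid" where
  "mu_h L N \<theta>0 \<epsilon> \<sigma> \<tau> u v w = (\<lambda>i j k.
      quot_plus (u i j k) (v i j k) + quot_minus (u i j k) (v i j k)
    - \<theta>0 * (3 / 2 * v i j k - 1 / 2 * w i j k)
    - \<epsilon>\<^sup>2 * laplacian (spacing L N) (\<lambda>a b c. 3 / 4 * u a b c + 1 / 4 * w a b c) i j k
    + \<sigma> * inv_neg_laplacian L N
        (\<lambda>a b c. (u a b c + v a b c) / 2 - mean L N (\<lambda>a b c. (u a b c + v a b c) / 2)) i j k
    + \<tau> * (ln (1 + u i j k) - ln (1 + v i j k) - ln (1 - u i j k) + ln (1 - v i j k)))"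

definition mobility_face :: "(real \<Rightarrow> real) \<Rightarrow> real \<Rightarrow> grid \<Rightarrow> grid \<Rightarrow> face" where
  "mobility_face M \<tau> v w = face_map (\<lambda>a. sqrt (a\<^sup>2 + \<tau> ^ 6))
     (avg_face (\<lambda>i j k. 3 / 2 * M (v i j k) - 1 / 2 * M (w i j k)))"

end

theory Submission imports Defs "HOL-Analysis.Analysis" begin

text \<open>
  Existence is variational. Write \<open>u\<close> for the unknown and \<open>v\<close> for the previous time level. Inverting
  the elliptic operator of the scheme, a grid function \<open>u\<close> with the mean of \<open>v\<close> solves the scheme exactly if
  its chemical potential plus \<open>1/\<tau>\<close> times the inverse of minus that operator, applied to \<open>u - v\<close>, is
  constant. This is the Euler-Lagrange equation of a functional on the finite-dimensional set of grid
  functions with prescribed mean, consisting of a sum of functions of the single values of \<open>u\<close> and of a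
  quadratic function of \<open>u\<close>. A minimiser exists over all functions with values in \<open>[-r, r]\<close>. The derivative
  of the pointwise part tends to \<open>\<plusminus>\<infinity>\<close> at \<open>\<plusminus>1\<close> because of the logarithmic term with factor \<open>\<tau>\<close>, while all
  other derivatives remain bounded; hence for \<open>r\<close> close to \<open>1\<close> the minimiser avoids \<open>\<plusminus>r\<close> and satisfies
  the equation (\<open>constrained_critical_point\<close>, \<open>scheme_solution_exists\<close>).

  The inverses are given by symmetric matrices: summation by parts makes the operators symmetric, and by
  positivity of the coefficients their kernels consist of the constants (\<open>diffusion_by_parts\<close>,
  \<open>diffusion_kernel\<close>, \<open>green_matrix_exists\<close>).

  Uniqueness is monotonicity. The pointwise part of the chemical potential is strictly increasing in the
  unknown, since difference quotients of the convex functions \<open>G (1 + x)\<close> and \<open>G (1 - x)\<close> are nondecreasing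
  and the logarithmic term is strictly increasing; the other terms are positive semidefinite
  (\<open>site_potential_strict_mono\<close>, \<open>scheme_solution_unique\<close>).
\<close>

section \<open>Linear systems\<close>

text \<open>
  Gaussian elimination, by induction on the set of equations: one equation is solved for one unknown,
  which leaves one equation and one unknown fewer.
\<close>

lemma underdetermined_system:
  fixes A :: "'p \<Rightarrow> 'q \<Rightarrow> real"
  assumes "finite I" "finite J" "card I < card J"
  shows "\<exists>x. (\<exists>q\<in>J. x q \<noteq> 0) \<and> (\<forall>p\<in>I. (\<Sum>q\<in>J. A p q * x q) = 0)"
  using assms
proof (induction I arbitrary: J A rule: finite_induct)
  case empty
  then obtain q where "q \<in> J" by fastforce
  then show ?case by (intro exI[of _ "\<lambda>_. 1"]) auto
next
  case (insert p I)
  show ?case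
  proof (cases "\<forall>q\<in>J. A p q = 0")
    case True
    have "card I < card J" using insert by simp
    from insert.IH[OF insert.prems(1) this, of A] True show ?thesis by auto
  next
    case False
    then obtain r where r: "r \<in> J" "A p r \<noteq> 0" by auto
    define J' where "J' = J - {r}"
    have J': "finite J'" "r \<notin> J'" "J = insert r J'" using r insert.prems by (auto simp: J'_def)
    \<comment> \<open>The coefficients of the other equations after the unknown \<open>r\<close> has been eliminated by equation \<open>p\<close>.\<close>
    define A' where "A' = (\<lambda>s q. A s q - A s r / A p r * A p q)"
    have "card I < card J'" using insert J' by simp
    then obtain x where x: "\<exists>q\<in>J'. x q \<noteq> 0" "\<forall>s\<in>I. (\<Sum>q\<in>J'. A' s q * x q) = 0"
      using insert.IH[OF J'(1), of A'] by auto
    define c where "c = - (\<Sum>q\<in>J'. A p q * x q) / A p r"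
    define y where "y = x(r := c)"
    have split: "(\<Sum>q\<in>J. A s q * y q) = A s r * c + (\<Sum>q\<in>J'. A s q * x q)" for s
    proof -
      have "(\<Sum>q\<in>J'. A s q * y q) = (\<Sum>q\<in>J'. A s q * x q)"
        using J'(2) by (intro sum.cong) (auto simp: y_def)
      then show ?thesis using J' by (simp add: y_def)
    qed
    have "(\<Sum>q\<in>J. A s q * y q) = 0" if "s \<in> I" for s
    proof -
      have "0 = (\<Sum>q\<in>J'. A s q * x q) - A s r / A p r * (\<Sum>q\<in>J'. A p q * x q)"
        using x(2) that by (simp add: A'_def left_diff_distrib sum_subtractf sum_distrib_left mult.assoc)
      moreover have "A s r * c = - (A s r / A p r * (\<Sum>q\<in>J'. A p q * x q))"
        by (simp add: c_def)
      ultimately show ?thesis unfolding split by linarith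
    qed
    moreover have "(\<Sum>q\<in>J. A p q * y q) = 0"
      unfolding split c_def using r by simp
    moreover have "\<exists>q\<in>J. y q \<noteq> 0" using x(1) J' by (auto simp: y_def)
    ultimately show ?thesis by blast
  qed
qed

text \<open>
  Appending the column \<open>- g\<close> gives a system with more unknowns than equations. In a nontrivial solution
  the extra unknown cannot vanish, since the rest would then be a nonzero element of the kernel of \<open>A\<close>;
  division by it yields a solution with right-hand side \<open>g\<close>.
\<close>

lemma injective_matrix_solvable:
  fixes A :: "'p \<Rightarrow> 'p \<Rightarrow> real"
  assumes fin: "finite I"
    and inj: "\<And>x. (\<forall>p\<in>I. (\<Sum>q\<in>I. A p q * x q) = 0) \<Longrightarrow> \<forall>q\<in>I. x q = 0"
  shows "\<exists>x. \<forall>p\<in>I. (\<Sum>q\<in>I. A p q * x q) = g p"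
proof -
  define J where "J = insert None (Some ` I)"
  define B where "B = (\<lambda>p. case_option (- g p) (A p))"
  have "card I < card J" "finite J"
    using fin by (simp_all add: J_def card_image)
  from underdetermined_system[OF fin this(2,1), of B]
  obtain y where y: "\<exists>q\<in>J. y q \<noteq> 0" "\<forall>p\<in>I. (\<Sum>q\<in>J. B p q * y q) = 0" by blast
  have eq: "(\<Sum>q\<in>I. A p q * y (Some q)) = g p * y None" if "p \<in> I" for p
  proof -
    have "(\<Sum>q\<in>J. B p q * y q) = - g p * y None + (\<Sum>q\<in>I. A p q * y (Some q))"
      using fin by (simp add: J_def B_def sum.reindex)
    then show ?thesis using y(2) that by simp
  qed
  have "y None \<noteq> 0"
  proof
    assume "y None = 0"
    with eq have "\<forall>p\<in>I. (\<Sum>q\<in>I. A p q * y (Some q)) = 0" by simp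
    then have "\<forall>q\<in>I. y (Some q) = 0" by (rule inj)
    with y(1) \<open>y None = 0\<close> show False by (auto simp: J_def)
  qed
  then have "\<forall>p\<in>I. (\<Sum>q\<in>I. A p q * (y (Some q) / y None)) = g p"
    using eq by (simp flip: sum_divide_distrib)
  then show ?thesis by (rule exI[where x = "\<lambda>q. y (Some q) / y None"])
qed

text \<open>
  A symmetric matrix whose kernel consists of the constant vectors becomes injective when the all-ones
  matrix is added. The inverse of that sum is symmetric and inverts \<open>A\<close> on the vectors of sum zero: the
  column sums of \<open>A\<close> vanish, so a solution for a right-hand side of sum zero has itself sum zero and does
  not see the added ones.
\<close>

lemma green_matrix_exists:
  fixes A :: "'p \<Rightarrow> 'p \<Rightarrow> real"
  assumes fin: "finite I" and ne: "I \<noteq> {}"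
    and sym: "\<And>p q. p \<in> I \<Longrightarrow> q \<in> I \<Longrightarrow> A p q = A q p"
    and rows: "\<And>p. p \<in> I \<Longrightarrow> (\<Sum>q\<in>I. A p q) = 0"
    and ker: "\<And>x p q. (\<forall>p\<in>I. (\<Sum>q\<in>I. A p q * x q) = 0) \<Longrightarrow> p \<in> I \<Longrightarrow> q \<in> I \<Longrightarrow> x p = x q"
  obtains R where "\<And>p q. p \<in> I \<Longrightarrow> q \<in> I \<Longrightarrow> R p q = R q p"
    and "\<And>g p. (\<Sum>q\<in>I. g q) = 0 \<Longrightarrow> p \<in> I \<Longrightarrow>
           (\<Sum>q\<in>I. A p q * (\<Sum>s\<in>I. R q s * g s)) = g p"
    and "\<And>g. (\<Sum>q\<in>I. g q) = 0 \<Longrightarrow> (\<Sum>p\<in>I. \<Sum>q\<in>I. R p q * g q) = 0"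
proof -
  define P where "P = (\<lambda>p q. A p q + 1)"
  have Psym: "P p q = P q p" if "p \<in> I" "q \<in> I" for p q using sym that by (simp add: P_def)
  have cpos: "real (card I) > 0" using fin ne by (simp add: card_gt_0_iff)
  have Pmul: "(\<Sum>q\<in>I. P p q * x q) = (\<Sum>q\<in>I. A p q * x q) + (\<Sum>q\<in>I. x q)" for p x
    by (simp add: P_def distrib_right sum.distrib)
  have colA: "(\<Sum>p\<in>I. \<Sum>q\<in>I. A p q * x q) = 0" for x
  proof -
    have "(\<Sum>p\<in>I. \<Sum>q\<in>I. A p q * x q) = (\<Sum>q\<in>I. (\<Sum>p\<in>I. A q p) * x q)"
      unfolding sum_distrib_right by (subst sum.swap) (intro sum.cong refl, metis sym)
    also have "\<dots> = 0" using rows by simp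
    finally show ?thesis .
  qed
  have split: "(\<Sum>q\<in>I. x q) = 0 \<and> (\<forall>p\<in>I. (\<Sum>q\<in>I. A p q * x q) = g p)"
    if eq: "\<forall>p\<in>I. (\<Sum>q\<in>I. P p q * x q) = g p" and g: "(\<Sum>q\<in>I. g q) = 0" for x g
  proof -
    have "0 = (\<Sum>p\<in>I. \<Sum>q\<in>I. P p q * x q)" using eq g by simp
    also have "\<dots> = real (card I) * (\<Sum>q\<in>I. x q)"
      unfolding Pmul by (simp add: sum.distrib colA)
    finally have "(\<Sum>q\<in>I. x q) = 0" using cpos by simp
    with eq show ?thesis by (simp add: Pmul)
  qed
  have injP: "\<forall>q\<in>I. x q = 0" if "\<forall>p\<in>I. (\<Sum>q\<in>I. P p q * x q) = 0" for x
  proof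
    fix q assume q: "q \<in> I"
    have s: "(\<Sum>q\<in>I. x q) = 0" "\<forall>p\<in>I. (\<Sum>q\<in>I. A p q * x q) = 0"
      using split[of x "\<lambda>_. 0"] that by auto
    have "(\<Sum>p\<in>I. x p) = (\<Sum>p\<in>I. x q)" using ker[OF s(2) _ q] by (intro sum.cong) auto
    then show "x q = 0" using s(1) cpos by simp
  qed
  have "\<forall>s. \<exists>x. \<forall>p\<in>I. (\<Sum>q\<in>I. P p q * x q) = (if p = s then 1 else 0)"
    by (rule allI, rule injective_matrix_solvable[OF fin], rule injP)
  then obtain X where X: "\<And>s p. p \<in> I \<Longrightarrow> (\<Sum>q\<in>I. P p q * X s q) = (if p = s then 1 else 0)"
    by metis
  have Xsym: "X s t = X t s" if st: "s \<in> I" "t \<in> I" for s t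
  proof -
    have "X s t = (\<Sum>p\<in>I. (\<Sum>q\<in>I. P p q * X t q) * X s p)"
      using X st fin by (simp add: if_distrib[of "\<lambda>a. a * _"] cong: if_cong)
    also have "\<dots> = (\<Sum>q\<in>I. (\<Sum>p\<in>I. P q p * X s p) * X t q)"
    proof -
      have "(\<Sum>p\<in>I. (\<Sum>q\<in>I. P p q * X t q) * X s p) = (\<Sum>p\<in>I. \<Sum>q\<in>I. P p q * X t q * X s p)"
        by (simp add: sum_distrib_right)
      also have "\<dots> = (\<Sum>q\<in>I. \<Sum>p\<in>I. P p q * X t q * X s p)" by (rule sum.swap)
      also have "\<dots> = (\<Sum>q\<in>I. \<Sum>p\<in>I. P q p * X s p * X t q)"
        using Psym by (intro sum.cong refl) (metis mult.assoc mult.commute)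
      finally show ?thesis by (simp add: sum_distrib_right)
    qed
    also have "\<dots> = X t s"
      using X st fin by (simp add: if_distrib[of "\<lambda>a. a * _"] cong: if_cong)
    finally show ?thesis .
  qed
  define R where "R = (\<lambda>p q. X q p)"
  have PR: "(\<Sum>q\<in>I. P p q * (\<Sum>s\<in>I. R q s * g s)) = g p" if "p \<in> I" for p g
  proof -
    have "(\<Sum>q\<in>I. P p q * (\<Sum>s\<in>I. R q s * g s)) = (\<Sum>s\<in>I. (\<Sum>q\<in>I. P p q * X s q) * g s)"
      unfolding sum_distrib_left sum_distrib_right R_def by (subst sum.swap) (simp add: mult.assoc)
    also have "\<dots> = g p"
      using X that fin by (simp add: if_distrib[of "\<lambda>a. a * _"] cong: if_cong)
    finally show ?thesis .
  qed
  show thesis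
  proof
    show "R p q = R q p" if "p \<in> I" "q \<in> I" for p q using Xsym that by (simp add: R_def)
    show "(\<Sum>q\<in>I. A p q * (\<Sum>s\<in>I. R q s * g s)) = g p" if "(\<Sum>q\<in>I. g q) = 0" "p \<in> I" for g p
      using split[of "\<lambda>q. \<Sum>s\<in>I. R q s * g s" g] PR that by simp
    show "(\<Sum>p\<in>I. \<Sum>q\<in>I. R p q * g q) = 0" if "(\<Sum>q\<in>I. g q) = 0" for g
      using split[of "\<lambda>q. \<Sum>s\<in>I. R q s * g s" g] PR that by simp
  qed
qed

section \<open>Minimisation under a constraint on the sum\<close>

text \<open>
  This is the existence part of the theorem in coordinates. With antiderivatives \<open>F p\<close> of the \<open>f p\<close>, the
  claimed equations say that \<open>u\<close> is a critical point of
  \<open>(\<Sum>p. F p (u p)) + 1/2 * (\<Sum>p q. B p q * u p * u q) + (\<Sum>p. b p * u p)\<close> under the constraint that the sum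
  of \<open>u\<close> is fixed, the constant \<open>c\<close> being the Lagrange multiplier. The functional is minimised over the
  compact set of those \<open>u\<close> with values in \<open>[-r, r]\<close>. The quadratic and linear terms have derivatives
  bounded independently of \<open>r < 1\<close>, whereas \<open>f p\<close> is unbounded near \<open>-1\<close> and \<open>1\<close>. For \<open>r\<close> close to \<open>1\<close> the
  minimiser therefore stays off the boundary: a component equal to \<open>r\<close> could be lowered in favour of a
  component that is at most the average \<open>m\<close>, with a smaller value of the functional.
\<close>

lemma constrained_critical_point:
  fixes I :: "'p set" and f :: "'p \<Rightarrow> real \<Rightarrow> real" and B :: "'p \<Rightarrow> 'p \<Rightarrow> real"
    and b :: "'p \<Rightarrow> real" and m :: real
  assumes fin: "finite I" and ne: "I \<noteq> {}" and m: "\<bar>m\<bar> < 1"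
    and cont: "\<And>p. p \<in> I \<Longrightarrow> continuous_on {-1<..<1} (f p)"
    and mono: "\<And>p. p \<in> I \<Longrightarrow> mono_on {-1<..<1} (f p)"
    and top: "\<And>p. p \<in> I \<Longrightarrow> filterlim (f p) at_top (at_left 1)"
    and bot: "\<And>p. p \<in> I \<Longrightarrow> filterlim (f p) at_bot (at_right (-1))"
    and sym: "\<And>p q. p \<in> I \<Longrightarrow> q \<in> I \<Longrightarrow> B p q = B q p"
  shows "\<exists>u c. (\<forall>p\<in>I. \<bar>u p\<bar> < 1) \<and> (\<Sum>p\<in>I. u p) = real (card I) * m
           \<and> (\<forall>p\<in>I. f p (u p) + (\<Sum>q\<in>I. B p q * u q) + b p = c)"
proof -
  \<comment> \<open>\<open>2 * C\<close> dominates the lower-order terms of two gradient components together with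
    the value \<open>f p m\<close> that is compared with \<open>f q r\<close> and \<open>f q (- r)\<close> below.\<close>
  define C where "C = (\<Sum>p\<in>I. \<bar>b p\<bar> + (\<Sum>q\<in>I. \<bar>B p q\<bar>)) + (\<Sum>p\<in>I. \<bar>f p m\<bar>)"
  have "eventually (\<lambda>x. \<forall>p\<in>I. 2 * C < f p x) (at_left (1::real))"
    using top fin by (intro eventually_ball_finite) (auto simp: filterlim_at_top_dense)
  then obtain r1 where r1: "r1 < 1" "\<And>x p. r1 < x \<Longrightarrow> x < 1 \<Longrightarrow> p \<in> I \<Longrightarrow> 2 * C < f p x"
    by (auto simp: eventually_at_left[of 0 1])
  have "eventually (\<lambda>x. \<forall>p\<in>I. f p x < - 2 * C) (at_right (-1::real))"
    using bot fin by (intro eventually_ball_finite) (auto simp: filterlim_at_bot_dense)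
  then obtain r2 where r2: "r2 > -1" "\<And>x p. -1 < x \<Longrightarrow> x < r2 \<Longrightarrow> p \<in> I \<Longrightarrow> f p x < - 2 * C"
    by (auto simp: eventually_at_right[of "-1" 0])
  define s where "s = max r1 (max (- r2) \<bar>m\<bar>)"
  define r where "r = (s + 1) / 2"
  have "s < 1" "r1 \<le> s" "- r2 \<le> s" "\<bar>m\<bar> \<le> s" using r1(1) r2(1) m by (auto simp: s_def)
  then have r: "\<bar>m\<bar> < r" "r < 1" "r1 < r" "- r < r2" by (auto simp: r_def field_simps)
  then have r0: "0 < r" by linarith
  have fr: "2 * C < f p r" "f p (- r) < - 2 * C" if "p \<in> I" for p
    using r1(2)[of r p] r2(2)[of "-r" p] that r r0 by auto

  have "\<exists>F. \<forall>x\<in>{-r..r}. (F has_real_derivative f p x) (at x)" if "p \<in> I" for p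
  proof -
    \<comment> \<open>Integrating over the larger interval \<open>[-s, s]\<close> makes the derivatives two-sided at \<open>r\<close> and \<open>- r\<close>.\<close>
    define s where "s = (r + 1) / 2"
    have s: "r < s" "s < 1" using r by (auto simp: s_def)
    have "continuous_on {-s..s} (f p)"
      using cont[OF that] s by (rule_tac continuous_on_subset) auto
    then obtain F where F: "\<And>x. x \<in> {-s..s} \<Longrightarrow> (F has_vector_derivative f p x) (at x within {-s..s})"
      by (rule antiderivative_continuous) blast
    have "(F has_real_derivative f p x) (at x)" if "x \<in> {-r..r}" for x
      using F[of x] that s by (simp add: has_real_derivative_iff_has_vector_derivative at_within_Icc_at)
    then show ?thesis by blast
  qed
  then obtain F where F: "\<And>p x. p \<in> I \<Longrightarrow> x \<in> {-r..r} \<Longrightarrow> (F p has_real_derivative f p x) (at x)"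
    by metis

  define J where "J = (\<lambda>u. (\<Sum>p\<in>I. F p (u p)) + (\<Sum>p\<in>I. \<Sum>q\<in>I. B p q * (u p * u q)) / 2 + (\<Sum>p\<in>I. b p * u p))"
  define T where "T = (\<lambda>u p. f p (u p) + (\<Sum>q\<in>I. B p q * u q) + b p)"
  define box where "box = PiE UNIV (\<lambda>p. if p \<in> I then {-r..r} else {0::real})"
  define K where "K = box \<inter> {u. (\<Sum>p\<in>I. u p) = real (card I) * m}"

  have coord: "continuous_on S (\<lambda>u::'p \<Rightarrow> real. u p)" for S p
    by (rule continuous_on_subset[OF continuous_on_product_coordinates subset_UNIV])
  have "compactin (product_topology (\<lambda>_. euclidean) UNIV) box"
    unfolding box_def by (subst compactin_PiE) auto
  then have "compact box"
    by (simp add: euclidean_product_topology)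
  moreover have "closed {u. (\<Sum>p\<in>I. u p) = real (card I) * m}"
    by (intro closed_Collect_eq continuous_intros coord)
  ultimately have "compact K" unfolding K_def by (rule compact_Int_closed)
  have Kbox: "u p \<in> {-r..r}" if "u \<in> K" "p \<in> I" for u p
    using that by (auto simp: K_def box_def PiE_iff split: if_splits)
  have "(\<lambda>p. if p \<in> I then m else 0) \<in> K"
    using r by (auto simp: K_def box_def)
  then have "K \<noteq> {}" by blast
  have "continuous_on K J"
  proof -
    have "continuous_on K (\<lambda>u. F p (u p))" if "p \<in> I" for p
    proof (rule continuous_on_compose2[where g = "F p" and f = "\<lambda>u. u p" and t = "{-r..r}"])
      show "continuous_on {-r..r} (F p)"
        using F[OF that] by (intro DERIV_continuous_on) (blast intro: DERIV_subset)
    qed (use Kbox that coord in auto)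
    then show ?thesis unfolding J_def by (intro continuous_intros coord) auto
  qed
  then obtain u where u: "u \<in> K" and umin: "\<And>w. w \<in> K \<Longrightarrow> J u \<le> J w"
    using continuous_attains_inf[OF \<open>compact K\<close> \<open>K \<noteq> {}\<close>] by blast
  have usum: "(\<Sum>p\<in>I. u p) = real (card I) * m" using u by (simp add: K_def)

  \<comment> \<open>First-order optimality: shifting a little mass from \<open>q\<close> to \<open>p\<close> is admissible, so it does not lower \<open>J\<close>.\<close>
  have opt: "T u q \<le> T u p" if pq: "p \<in> I" "q \<in> I" and up: "u p < r" and uq: "- r < u q" for p q
  proof (cases "p = q")
    case False
    define d where "d = (\<lambda>s. if s = p then 1 else if s = q then - 1 else (0::real))"
    have dsum: "(\<Sum>s\<in>I. a s * d s) = a p - a q" for a :: "'p \<Rightarrow> real"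
    proof -
      have "(\<Sum>s\<in>I. a s * d s) = (\<Sum>s\<in>I. (if s = p then a s else 0) - (if s = q then a s else 0))"
        using False by (intro sum.cong) (auto simp: d_def)
      then show ?thesis using fin pq by (simp add: sum_subtractf)
    qed
    define j where "j = (\<lambda>t. J (\<lambda>s. u s + t * d s))"
    have Fd: "((\<lambda>t. F s (u s + t * d s)) has_real_derivative f s (u s) * d s) (at 0)" if "s \<in> I" for s
    proof -
      have "(F s has_real_derivative f s (u s)) (at (u s + 0 * d s))" using F[OF that Kbox[OF u that]] by simp
      moreover have "((\<lambda>t. u s + t * d s) has_real_derivative d s) (at 0)"
        by (auto intro!: derivative_eq_intros)
      ultimately show ?thesis by (rule DERIV_chain2)
    qed
    have "(j has_real_derivative (\<Sum>s\<in>I. f s (u s) * d s)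
        + (\<Sum>s\<in>I. \<Sum>s'\<in>I. B s s' * (d s * u s' + u s * d s')) / 2 + (\<Sum>s\<in>I. b s * d s)) (at 0)"
      unfolding j_def J_def
      by (intro DERIV_add DERIV_sum DERIV_cdivide Fd) (auto intro!: derivative_eq_intros)
    also have "(\<Sum>s\<in>I. \<Sum>s'\<in>I. B s s' * (d s * u s' + u s * d s')) / 2 = (\<Sum>s\<in>I. (\<Sum>s'\<in>I. B s s' * u s') * d s)"
    proof -
      have "(\<Sum>s\<in>I. \<Sum>s'\<in>I. B s s' * (u s * d s')) = (\<Sum>s'\<in>I. \<Sum>s\<in>I. B s s' * (u s * d s'))"
        by (rule sum.swap)
      also have "\<dots> = (\<Sum>s\<in>I. \<Sum>s'\<in>I. B s s' * (d s * u s'))"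
      proof (intro sum.cong refl)
        fix s s' assume "s \<in> I" "s' \<in> I"
        then show "B s' s * (u s' * d s) = B s s' * (d s * u s')"
          using sym[of s' s] by simp
      qed
      finally have "(\<Sum>s\<in>I. \<Sum>s'\<in>I. B s s' * (d s * u s' + u s * d s')) = 2 * (\<Sum>s\<in>I. \<Sum>s'\<in>I. B s s' * (d s * u s'))"
        by (simp add: distrib_left sum.distrib)
      moreover have "(\<Sum>s'\<in>I. B s s' * u s') * d s = (\<Sum>s'\<in>I. B s s' * (d s * u s'))" for s
        by (simp add: sum_distrib_right mult.assoc mult.commute[of "d s"])
      ultimately show ?thesis by simp
    qed
    also have "(\<Sum>s\<in>I. f s (u s) * d s) + (\<Sum>s\<in>I. (\<Sum>s'\<in>I. B s s' * u s') * d s) + (\<Sum>s\<in>I. b s * d s)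
        = T u p - T u q"
      unfolding dsum T_def by simp
    finally have dj: "(j has_real_derivative T u p - T u q) (at 0)" .
    show ?thesis
    proof (rule ccontr)
      assume "\<not> T u q \<le> T u p"
      then have "T u p - T u q < 0" by simp
      from has_real_derivative_neg_dec_right[OF dj this]
      obtain e where e: "e > 0" "\<And>h. h > 0 \<Longrightarrow> h < e \<Longrightarrow> j h < j 0" by auto
      define h where "h = min (e / 2) (min (r - u p) (u q + r))"
      have h: "h > 0" "h < e" "u p + h \<le> r" "u q - h \<ge> - r"
        using e(1) up uq by (auto simp: h_def min_def)
      have "(\<lambda>s. u s + h * d s) \<in> K"
      proof -
        have "(\<Sum>s\<in>I. u s + h * d s) = real (card I) * m"
          using usum dsum[of "\<lambda>_. h"] by (simp add: sum.distrib)
        moreover have "u s + h * d s \<in> (if s \<in> I then {-r..r} else {0})" for s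
        proof (cases "s \<in> I")
          case True
          then show ?thesis using Kbox[OF u True] h by (auto simp: d_def)
        next
          case s: False
          then have "u s = 0" using u by (auto simp: K_def box_def PiE_iff split: if_splits)
          then show ?thesis using s pq by (auto simp: d_def)
        qed
        ultimately show ?thesis by (auto simp: K_def box_def)
      qed
      from umin[OF this] have "j 0 \<le> j h" by (simp add: j_def)
      with e(2)[of h] h show False by simp
    qed
  qed simp

  have Tf: "\<bar>T u p - f p (u p)\<bar> \<le> C - (\<Sum>p\<in>I. \<bar>f p m\<bar>)" if "p \<in> I" for p
  proof -
    have "\<bar>T u p - f p (u p)\<bar> \<le> \<bar>\<Sum>q\<in>I. B p q * u q\<bar> + \<bar>b p\<bar>"
      unfolding T_def by linarith
    also have "\<bar>\<Sum>q\<in>I. B p q * u q\<bar> \<le> (\<Sum>q\<in>I. \<bar>B p q * u q\<bar>)" by (rule sum_abs)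
    also have "\<dots> \<le> (\<Sum>q\<in>I. \<bar>B p q\<bar>)"
    proof (rule sum_mono)
      fix q assume "q \<in> I"
      then have "\<bar>u q\<bar> \<le> 1" using Kbox[OF u] r by force
      then show "\<bar>B p q * u q\<bar> \<le> \<bar>B p q\<bar>" by (simp add: abs_mult mult_left_le)
    qed
    also have "(\<Sum>q\<in>I. \<bar>B p q\<bar>) + \<bar>b p\<bar> \<le> (\<Sum>p\<in>I. \<bar>b p\<bar> + (\<Sum>q\<in>I. \<bar>B p q\<bar>))"
      using member_le_sum[OF that, of "\<lambda>p. \<bar>b p\<bar> + (\<Sum>q\<in>I. \<bar>B p q\<bar>)"] fin
      by (simp add: sum_nonneg)
    finally show ?thesis by (simp add: C_def)
  qed
  have fm: "\<bar>f p m\<bar> \<le> (\<Sum>p\<in>I. \<bar>f p m\<bar>)" if "p \<in> I" for p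
    using member_le_sum[OF that, of "\<lambda>p. \<bar>f p m\<bar>"] fin by simp
  have fm0: "0 \<le> (\<Sum>p\<in>I. \<bar>f p m\<bar>)" by (simp add: sum_nonneg)
  \<comment> \<open>At a component touching \<open>r\<close>, \<open>opt\<close> contradicts the size of \<open>f q r\<close>.\<close>
  have upper: "u q < r" if q: "q \<in> I" for q
  proof (rule ccontr)
    assume "\<not> u q < r"
    then have uq: "u q = r" using Kbox[OF u q] by simp
    have "\<exists>p\<in>I. u p \<le> m"
    proof (rule ccontr)
      assume "\<not> (\<exists>p\<in>I. u p \<le> m)"
      then have "(\<Sum>p\<in>I. m) < (\<Sum>p\<in>I. u p)" using fin ne by (intro sum_strict_mono) auto
      then show False using usum by simp
    qed
    then obtain p where p: "p \<in> I" "u p \<le> m" by blast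
    have "T u q \<le> T u p" using opt[OF p(1) q] p r r0 uq by simp
    moreover have "f p (u p) \<le> f p m"
      using mono_onD[OF mono[OF p(1)], of "u p" m] p Kbox[OF u p(1)] r by auto
    ultimately show False
      using Tf[OF p(1)] Tf[OF q] fm[OF p(1)] fr[OF q] fm0 unfolding uq by linarith
  qed
  have lower: "- r < u q" if q: "q \<in> I" for q
  proof (rule ccontr)
    assume "\<not> - r < u q"
    then have uq: "u q = - r" using Kbox[OF u q] by simp
    have "\<exists>p\<in>I. m \<le> u p"
    proof (rule ccontr)
      assume "\<not> (\<exists>p\<in>I. m \<le> u p)"
      then have "(\<Sum>p\<in>I. u p) < (\<Sum>p\<in>I. m)" using fin ne by (intro sum_strict_mono) auto
      then show False using usum by simp
    qed
    then obtain p where p: "p \<in> I" "m \<le> u p" by blast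
    have "T u p \<le> T u q" using opt[OF q p(1)] p r r0 uq by simp
    moreover have "f p m \<le> f p (u p)"
      using mono_onD[OF mono[OF p(1)], of m "u p"] p Kbox[OF u p(1)] r by auto
    ultimately show False
      using Tf[OF p(1)] Tf[OF q] fm[OF p(1)] fr[OF q] fm0 unfolding uq by linarith
  qed
  obtain p0 where p0: "p0 \<in> I" using ne by blast
  have "T u p = T u p0" if "p \<in> I" for p
    using opt[OF that p0] opt[OF p0 that] upper lower that p0 by fastforce
  moreover have "\<bar>u p\<bar> < 1" if "p \<in> I" for p
    using upper[OF that] lower[OF that] r by linarith
  ultimately show ?thesis using usum unfolding T_def by blast
qed

section \<open>The pointwise nonlinearity\<close>

text \<open>
  By the mean value theorem a difference quotient of \<open>g\<close> is a value of the nondecreasing function \<open>g'\<close>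
  between the two points. On one side of \<open>v\<close>, the quotient at the farther point is a weighted average of
  the quotient at the nearer point and of a difference quotient over the remaining interval, which lies
  farther out. Continuity at \<open>v\<close> is the differentiability of \<open>g\<close> there.
\<close>

lemma difference_quotient_mono_continuous:
  fixes g g' :: "real \<Rightarrow> real" and a b v :: real
  defines "q \<equiv> \<lambda>x. if x = v then g' v else (g x - g v) / (x - v)"
  assumes v: "v \<in> {a<..<b}"
    and der: "\<And>x. x \<in> {a<..<b} \<Longrightarrow> (g has_real_derivative g' x) (at x)"
    and mono: "mono_on {a<..<b} g'"
  shows "mono_on {a<..<b} q" and "continuous_on {a<..<b} q"
proof -
  have mvt: "\<exists>z. x < z \<and> z < y \<and> g y - g x = (y - x) * g' z" if "x < y" "a < x" "y < b" for x y
    using MVT2[of x y g g'] der that by auto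
  have qv: "q v = g' v" by (simp add: q_def)
  have qmul: "q x * (x - v) = g x - g v" for x by (simp add: q_def)
  have qeqI: "q x = c" if "g x - g v = (x - v) * c" "x \<noteq> v" for x c
  proof -
    have "q x * (x - v) = c * (x - v)" using qmul[of x] that(1) by (simp add: mult.commute)
    then show ?thesis using that(2) by simp
  qed
  have below: "q x \<le> g' v" if x: "a < x" "x < v" for x
  proof -
    obtain z where z: "x < z" "z < v" "g v - g x = (v - x) * g' z" using mvt[of x v] x v by auto
    have "g x - g v = (x - v) * g' z" using z(3) by (simp add: algebra_simps)
    then have "q x = g' z" using x by (intro qeqI) auto
    then show ?thesis using mono_onD[OF mono, of z v] z x v by auto
  qed
  have above: "g' v \<le> q x" if x: "v < x" "x < b" for x
  proof -
    obtain z where z: "v < z" "z < x" "g x - g v = (x - v) * g' z" using mvt[of v x] x v by auto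
    then have "q x = g' z" using x by (intro qeqI) auto
    then show ?thesis using mono_onD[OF mono, of v z] z x v by auto
  qed
  show "mono_on {a<..<b} q"
  proof (rule mono_onI)
    fix x y assume xy: "x \<in> {a<..<b}" "y \<in> {a<..<b}" "x \<le> y"
    consider "x = y" | "x \<le> v" "v \<le> y" | "x < y" "v < x" | "x < y" "y < v" using xy(3) by linarith
    then show "q x \<le> q y"
    proof cases
      case 2
      then show ?thesis using below[of x] above[of y] xy qv
        by (cases "x = v"; cases "y = v") auto
    next
      case 3
      obtain z where z: "x < z" "z < y" "g y - g x = (y - x) * g' z" using mvt[of x y] xy 3 by auto
      obtain w where w: "v < w" "w < x" "g x - g v = (x - v) * g' w" using mvt[of v x] xy 3 v by auto
      have qx: "q x = g' w" using w 3 by (intro qeqI) auto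
      have "g' w \<le> g' z" using mono_onD[OF mono, of w z] z w xy v by auto
      then have "(y - x) * q x \<le> g y - g x" using z qx 3 by (simp add: mult_left_mono)
      then have "(q x - q y) * (y - v) \<le> 0" using qmul[of x] qmul[of y] by (simp add: algebra_simps)
      then show ?thesis using 3 by (simp add: mult_le_0_iff)
    next
      case 4
      obtain z where z: "x < z" "z < y" "g y - g x = (y - x) * g' z" using mvt[of x y] xy 4 by auto
      obtain w where w: "y < w" "w < v" "g v - g y = (v - y) * g' w" using mvt[of y v] xy 4 v by auto
      have "g y - g v = (y - v) * g' w" using w(3) by (simp add: algebra_simps)
      then have qy: "q y = g' w" using 4 by (intro qeqI) auto
      have "g' z \<le> g' w" using mono_onD[OF mono, of z w] z w xy v by auto
      then have "g y - g x \<le> (y - x) * q y" using z qy 4 by (simp add: mult_left_mono)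
      then have "(q x - q y) * (v - x) \<le> 0" using qmul[of x] qmul[of y] by (simp add: algebra_simps)
      then show ?thesis using 4 by (simp add: mult_le_0_iff)
    qed simp
  qed
  have "isCont q x" if x: "x \<in> {a<..<b}" for x
  proof (cases "x = v")
    case True
    from der[OF v] obtain k where k: "\<forall>z. g z - g v = k z * (z - v)" "isCont k v" "k v = g' v"
      unfolding CARAT_DERIV by blast
    have "k = q" using k by (auto simp: q_def)
    then show ?thesis using k True by simp
  next
    case False
    have "isCont (\<lambda>x. (g x - g v) / (x - v)) x"
      using False der[OF x, THEN DERIV_isCont] by (intro continuous_intros) auto
    moreover have "eventually (\<lambda>y. q y = (g y - g v) / (y - v)) (nhds x)"
      using t1_space_nhds[OF False] by eventually_elim (simp add: q_def)
    ultimately show ?thesis using isCont_cong[of q "\<lambda>y. (g y - g v) / (y - v)" x] by simp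
  qed
  then show "continuous_on {a<..<b} q" by (simp add: continuous_at_imp_continuous_on)
qed

text \<open>
  The part of the chemical potential that depends on the unknown only through its value \<open>x\<close> at the same
  cell; \<open>v\<close> is the value at the previous time level.
\<close>

definition site_potential :: "real \<Rightarrow> real \<Rightarrow> real \<Rightarrow> real" where
  "site_potential \<tau> v x = quot_plus x v + quot_minus x v
     + \<tau> * (ln (1 + x) - ln (1 + v) - ln (1 - x) + ln (1 - v))"

lemma G_has_derivative:
  "x > 0 \<Longrightarrow> (G has_real_derivative G' x) (at x)"
proof -
  assume x: "x > 0"
  have "((\<lambda>x. x * ln x) has_real_derivative G' x) (at x)"
    using x by (auto intro!: derivative_eq_intros simp: G'_def)
  moreover have "G = (\<lambda>x. x * ln x)" by (auto simp: G_def)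
  ultimately show ?thesis by simp
qed

lemma entropy_quotient_mono_continuous:
  assumes v: "v \<in> {-1<..<1}"
  shows "mono_on {-1<..<1} (\<lambda>x. quot_plus x v + quot_minus x v)"
    and "continuous_on {-1<..<1} (\<lambda>x. quot_plus x v + quot_minus x v)"
proof -
  have d1: "((\<lambda>x. G (1 + x)) has_real_derivative G' (1 + x)) (at x)" if x: "x \<in> {-1<..<1}" for x
  proof -
    have "(G has_real_derivative G' (1 + x)) (at (1 + x))" using x by (intro G_has_derivative) auto
    moreover have "((\<lambda>x. 1 + x) has_real_derivative 1) (at x)" by (auto intro!: derivative_eq_intros)
    ultimately show ?thesis using DERIV_chain2 by fastforce
  qed
  have d2: "((\<lambda>x. G (1 - x)) has_real_derivative - G' (1 - x)) (at x)" if x: "x \<in> {-1<..<1}" for x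
  proof -
    have "(G has_real_derivative G' (1 - x)) (at (1 - x))" using x by (intro G_has_derivative) auto
    moreover have "((\<lambda>x. 1 - x) has_real_derivative - 1) (at x)" by (auto intro!: derivative_eq_intros)
    ultimately show ?thesis using DERIV_chain2 by fastforce
  qed
  have m1: "mono_on {-1<..<1} (\<lambda>x. G' (1 + x))" and m2: "mono_on {-1<..<1} (\<lambda>x. - G' (1 - x))"
    by (auto intro!: mono_onI simp: G'_def)
  have e: "quot_plus x v = (if x = v then G' (1 + v) else (G (1 + x) - G (1 + v)) / (x - v))"
    "quot_minus x v = (if x = v then - G' (1 - v) else (G (1 - x) - G (1 - v)) / (x - v))" for x
    by (simp_all add: quot_plus_def quot_minus_def)
  have "mono_on {-1<..<1} (\<lambda>x. quot_plus x v)"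
    unfolding e using difference_quotient_mono_continuous(1)[OF v d1 m1] by simp
  moreover have "mono_on {-1<..<1} (\<lambda>x. quot_minus x v)"
    unfolding e using difference_quotient_mono_continuous(1)[OF v d2 m2] by simp
  ultimately show "mono_on {-1<..<1} (\<lambda>x. quot_plus x v + quot_minus x v)"
    unfolding mono_on_def by (meson add_mono)
  have "continuous_on {-1<..<1} (\<lambda>x. quot_plus x v)"
    unfolding e using difference_quotient_mono_continuous(2)[OF v d1 m1] by simp
  moreover have "continuous_on {-1<..<1} (\<lambda>x. quot_minus x v)"
    unfolding e using difference_quotient_mono_continuous(2)[OF v d2 m2] by simp
  ultimately show "continuous_on {-1<..<1} (\<lambda>x. quot_plus x v + quot_minus x v)"
    by (rule continuous_on_add)
qed

text \<open>
  The entropy quotients contribute a nondecreasing function; strictness comes from the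
  logarithmic term with the factor \<open>\<tau>\<close>.
\<close>

lemma site_potential_strict_mono:
  assumes v: "v \<in> {-1<..<1}" and \<tau>: "\<tau> > 0"
  shows "strict_mono_on {-1<..<1} (site_potential \<tau> v)"
proof (rule strict_mono_onI)
  fix x y :: real assume xy: "x \<in> {-1<..<1}" "y \<in> {-1<..<1}" "x < y"
  have "quot_plus x v + quot_minus x v \<le> quot_plus y v + quot_minus y v"
    using mono_onD[OF entropy_quotient_mono_continuous(1)[OF v] xy(1,2)] xy(3) by simp
  moreover have "ln (1 + x) < ln (1 + y)" "ln (1 - y) < ln (1 - x)" using xy by auto
  then have "\<tau> * (ln (1 + x) - ln (1 + v) - ln (1 - x) + ln (1 - v))
      < \<tau> * (ln (1 + y) - ln (1 + v) - ln (1 - y) + ln (1 - v))"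
    using \<tau> by (intro mult_strict_left_mono) auto
  ultimately show "site_potential \<tau> v x < site_potential \<tau> v y" by (simp add: site_potential_def)
qed

lemma site_potential_continuous:
  assumes v: "v \<in> {-1<..<1}"
  shows "continuous_on {-1<..<1} (site_potential \<tau> v)"
  unfolding site_potential_def
  by (intro continuous_on_add[OF entropy_quotient_mono_continuous(2)[OF v]] continuous_intros) auto

text \<open>
  For \<open>x > v\<close> monotonicity bounds the entropy quotients from below by their value at \<open>v\<close>, so the
  divergence of \<open>- \<tau> * ln (1 - x)\<close> prevails.
\<close>

lemma site_potential_at_top:
  assumes v: "v \<in> {-1<..<1}" and \<tau>: "\<tau> > 0"
  shows "filterlim (site_potential \<tau> v) at_top (at_left 1)"
proof (rule filterlim_at_top_mono)
  let ?c = "quot_plus v v + quot_minus v v"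
  have "filterlim (\<lambda>x::real. 1 - x) (at_right 0) (at_left 1)"
  unfolding filterlim_at
  proof
    show "eventually (\<lambda>x::real. 1 - x \<in> {0<..} \<and> 1 - x \<noteq> 0) (at_left 1)"
      by (rule eventually_at_leftI[of 0]) auto
    show "((\<lambda>x::real. 1 - x) \<longlongrightarrow> 0) (at_left 1)" by (auto intro!: tendsto_eq_intros)
  qed
  then have "filterlim (\<lambda>x::real. ln (1 - x)) at_bot (at_left 1)"
    by (rule filterlim_compose[OF ln_at_0])
  then have ln: "filterlim (\<lambda>x::real. - ln (1 - x)) at_top (at_left 1)"
    by (simp add: filterlim_uminus_at_bot)
  have "((\<lambda>x. ln (1 + x) - ln (1 + v) + ln (1 - v)) \<longlongrightarrow>
      ln (1 + 1) - ln (1 + v) + ln (1 - v)) (at_left (1::real))"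
    by (intro tendsto_intros) auto
  from filterlim_tendsto_add_at_top[OF this ln]
  have "filterlim (\<lambda>x. \<tau> * (ln (1 + x) - ln (1 + v) + ln (1 - v) + - ln (1 - x))) at_top (at_left 1)"
    by (rule filterlim_tendsto_pos_mult_at_top[OF tendsto_const \<tau>])
  then have "filterlim (\<lambda>x. \<tau> * (ln (1 + x) - ln (1 + v) - ln (1 - x) + ln (1 - v))) at_top (at_left 1)"
    by (rule filterlim_cong[THEN iffD1, rotated 3]) (auto simp: algebra_simps)
  then show "filterlim (\<lambda>x. ?c + \<tau> * (ln (1 + x) - ln (1 + v) - ln (1 - x) + ln (1 - v))) at_top (at_left 1)"
    by (rule filterlim_tendsto_add_at_top[OF tendsto_const])
  have "eventually (\<lambda>x. x \<in> {v<..<1}) (at_left (1::real))"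
    using v by (intro eventually_at_leftI[of v]) auto
  then show "eventually (\<lambda>x. ?c + \<tau> * (ln (1 + x) - ln (1 + v) - ln (1 - x) + ln (1 - v))
      \<le> site_potential \<tau> v x) (at_left 1)"
  proof eventually_elim
    case (elim x)
    then show ?case
      using mono_onD[OF entropy_quotient_mono_continuous(1)[OF v], of v x] v
      by (simp add: site_potential_def)
  qed
qed

lemma site_potential_uminus: "site_potential \<tau> (- v) (- x) = - site_potential \<tau> v x"
proof -
  have "quot_plus (- x) (- v) = - quot_minus x v" "quot_minus (- x) (- v) = - quot_plus x v"
    by (simp_all add: quot_plus_def quot_minus_def minus_divide_right)
  then show ?thesis by (simp add: site_potential_def algebra_simps)
qed

lemma site_potential_at_bot:
  assumes v: "v \<in> {-1<..<1}" and \<tau>: "\<tau> > 0"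
  shows "filterlim (site_potential \<tau> v) at_bot (at_right (-1))"
proof -
  have "filterlim (site_potential \<tau> (- v)) at_top (at_left 1)"
    using v \<tau> by (intro site_potential_at_top) auto
  then have "filterlim (\<lambda>x. site_potential \<tau> (- v) (- x)) at_top (at_right (- 1))"
    by (simp add: at_left_minus[of 1] filterlim_filtermap)
  then show ?thesis
    by (simp add: site_potential_uminus filterlim_uminus_at_bot)
qed

section \<open>Periodic grid functions\<close>

definition cell :: "nat \<Rightarrow> (int \<times> int \<times> int) set" where
  "cell N = {1..int N} \<times> {1..int N} \<times> {1..int N}"

definition at_node :: "grid \<Rightarrow> int \<times> int \<times> int \<Rightarrow> real" where
  "at_node u = (\<lambda>(i, j, k). u i j k)"

text \<open>
  The representative of \<open>i\<close> modulo \<open>N\<close> in \<open>{1..N}\<close>.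
\<close>

definition wrap :: "nat \<Rightarrow> int \<Rightarrow> int" where
  "wrap N i = (i - 1) mod int N + 1"

definition periodic_ext :: "nat \<Rightarrow> (int \<times> int \<times> int \<Rightarrow> real) \<Rightarrow> grid" where
  "periodic_ext N x = (\<lambda>i j k. x (wrap N i, wrap N j, wrap N k))"

lemma at_node_simp [simp]: "at_node u (i, j, k) = u i j k"
  by (simp add: at_node_def)

lemma finite_cell [simp]: "finite (cell N)"
  by (simp add: cell_def)

lemma card_cell [simp]: "card (cell N) = N ^ 3"
  by (simp add: cell_def card_cartesian_product power3_eq_cube)

lemma cell_nonempty: "N \<ge> 1 \<Longrightarrow> cell N \<noteq> {}"
  by (simp add: cell_def)

lemma V_perD:
  assumes "u \<in> V_per N"
  shows "u (i + int N) j k = u i j k" "u i (j + int N) k = u i j k" "u i j (k + int N) = u i j k"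
  using assms by (auto simp: V_per_def)

lemma periodic_add_multiple:
  fixes f :: "int \<Rightarrow> 'a"
  assumes "\<And>i. f (i + p) = f i"
  shows "f (i + p * k) = f i"
proof -
  have *: "f (i + p * int n) = f i" for i n
  proof (induction n)
    case (Suc n)
    have "f (i + p * int (Suc n)) = f ((i + p * int n) + p)" by (simp add: algebra_simps)
    then show ?case using assms Suc by simp
  qed simp
  show ?thesis
  proof (cases "k \<ge> 0")
    case True
    then show ?thesis using *[of i "nat k"] by simp
  next
    case False
    then show ?thesis using *[of "i + p * k" "nat (- k)"] by simp
  qed
qed

text \<open>
  Together with \<open>periodic_ext\<close> this identifies the periodic grid functions with the real functions on the
  finite set \<open>cell N\<close>, to which the linear algebra and the minimisation above apply.
\<close>

lemma V_per_wrap: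
  assumes "u \<in> V_per N"
  shows "u (wrap N i) (wrap N j) (wrap N k) = u i j k"
proof -
  have w: "wrap N i = i + int N * (- ((i - 1) div int N))" for i
    using mod_mult_div_eq[of "i - 1" "int N"] by (simp add: wrap_def algebra_simps)
  have "u (wrap N i) j k = u i j k" for i j k
    unfolding w using periodic_add_multiple[where f = "\<lambda>i. u i j k"] V_perD[OF assms] by blast
  moreover have "u i (wrap N j) k = u i j k" for i j k
    unfolding w using periodic_add_multiple[where f = "\<lambda>j. u i j k"] V_perD[OF assms] by blast
  moreover have "u i j (wrap N k) = u i j k" for i j k
    unfolding w using periodic_add_multiple[where f = "\<lambda>k. u i j k"] V_perD[OF assms] by blast
  ultimately show ?thesis by simp
qed

lemma wrap_in_cell: "N \<ge> 1 \<Longrightarrow> (wrap N i, wrap N j, wrap N k) \<in> cell N"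
proof -
  assume "N \<ge> 1"
  then have "0 \<le> m mod int N \<and> m mod int N < int N" for m by simp
  then have "1 \<le> wrap N i \<and> wrap N i \<le> int N" for i
    by (simp add: wrap_def zless_imp_add1_zle)
  then show ?thesis by (simp add: cell_def)
qed

lemma wrap_cell: "(i, j, k) \<in> cell N \<Longrightarrow> wrap N i = i \<and> wrap N j = j \<and> wrap N k = k"
  by (auto simp: cell_def wrap_def)

lemma wrap_add_period: "wrap N (i + int N) = wrap N i"
proof -
  have "i + int N - 1 = (i - 1) + int N" by simp
  then show ?thesis by (simp only: wrap_def mod_add_self2)
qed

lemma periodic_ext_V_per [simp]: "periodic_ext N x \<in> V_per N"
  by (simp add: V_per_def periodic_ext_def wrap_add_period)

lemma periodic_ext_cell [simp]: "p \<in> cell N \<Longrightarrow> at_node (periodic_ext N x) p = x p"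
  using wrap_cell by (cases p) (simp add: periodic_ext_def)

lemma periodic_ext_at_node: "u \<in> V_per N \<Longrightarrow> periodic_ext N (at_node u) = u"
  by (intro ext) (simp add: periodic_ext_def V_per_wrap)

lemma V_per_eqI:
  assumes "N \<ge> 1" "u \<in> V_per N" "w \<in> V_per N" "\<And>p. p \<in> cell N \<Longrightarrow> at_node u p = at_node w p"
  shows "u = w"
proof (intro ext)
  fix i j k
  have "u (wrap N i) (wrap N j) (wrap N k) = w (wrap N i) (wrap N j) (wrap N k)"
    using assms(4)[OF wrap_in_cell[OF assms(1)], of i j k] by simp
  then show "u i j k = w i j k" by (simp add: V_per_wrap assms)
qed

lemma sum_cell:
  "(\<Sum>p\<in>cell N. at_node u p) = (\<Sum>i\<in>{1..int N}. \<Sum>j\<in>{1..int N}. \<Sum>k\<in>{1..int N}. u i j k)"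
  by (simp add: cell_def at_node_def sum.cartesian_product)

lemma mean_eq:
  assumes "L > 0" "N \<ge> 1"
  shows "mean L N u = (\<Sum>p\<in>cell N. at_node u p) / real N ^ 3"
  using assms by (simp add: mean_def inner_grid_def spacing_def sum_cell power_divide)

lemma norm_inf_less_iff:
  assumes "N \<ge> 1"
  shows "norm_inf N u < c \<longleftrightarrow> (\<forall>p\<in>cell N. \<bar>at_node u p\<bar> < c)"
proof -
  have "norm_inf N u = Max ((\<lambda>p. \<bar>at_node u p\<bar>) ` cell N)"
    unfolding norm_inf_def cell_def by (intro arg_cong[where f = Max] image_cong) auto
  then show ?thesis using cell_nonempty[OF assms] by simp
qed

lemma sum_periodic_shift:
  fixes f :: "int \<Rightarrow> real"
  assumes "f (int N) = f 0"
  shows "(\<Sum>i\<in>{1..int N}. f (i - 1)) = (\<Sum>i\<in>{1..int N}. f i)"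
proof (cases "N = 0")
  case False
  have "(\<Sum>i\<in>{1..int N}. f (i - 1)) = (\<Sum>i\<in>{0..int N - 1}. f i)"
    by (rule sum.reindex_bij_witness[of _ "\<lambda>i. i + 1" "\<lambda>i. i - 1"]) auto
  also have "{0..int N - 1} = insert 0 {1..int N - 1}" using False by auto
  also have "sum f \<dots> = f (int N) + (\<Sum>i\<in>{1..int N - 1}. f i)" by (simp add: assms)
  also have "\<dots> = sum f (insert (int N) {1..int N - 1})" by simp
  also have "insert (int N) {1..int N - 1} = {1..int N}" using False by auto
  finally show ?thesis .
qed simp

lemma sum_cell_shift:
  assumes "u \<in> V_per N"
  shows "(\<Sum>p\<in>cell N. at_node (\<lambda>i j k. u (i - 1) j k) p) = (\<Sum>p\<in>cell N. at_node u p)"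
    and "(\<Sum>p\<in>cell N. at_node (\<lambda>i j k. u i (j - 1) k) p) = (\<Sum>p\<in>cell N. at_node u p)"
    and "(\<Sum>p\<in>cell N. at_node (\<lambda>i j k. u i j (k - 1)) p) = (\<Sum>p\<in>cell N. at_node u p)"
proof -
  have per: "u (int N) j k = u 0 j k" "u i (int N) k = u i 0 k" "u i j (int N) = u i j 0" for i j k
    using V_perD[OF assms, of 0 j k] V_perD[OF assms, of i 0 k] V_perD[OF assms, of i j 0] by simp_all
  show "(\<Sum>p\<in>cell N. at_node (\<lambda>i j k. u (i - 1) j k) p) = (\<Sum>p\<in>cell N. at_node u p)"
    unfolding sum_cell
    using sum_periodic_shift[of "\<lambda>i. \<Sum>j\<in>{1..int N}. \<Sum>k\<in>{1..int N}. u i j k" N] per by simp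
  show "(\<Sum>p\<in>cell N. at_node (\<lambda>i j k. u i (j - 1) k) p) = (\<Sum>p\<in>cell N. at_node u p)"
    unfolding sum_cell
    using sum_periodic_shift[of "\<lambda>j. \<Sum>k\<in>{1..int N}. u i j k" N for i] per
    by (simp cong: sum.cong_simp)
  show "(\<Sum>p\<in>cell N. at_node (\<lambda>i j k. u i j (k - 1)) p) = (\<Sum>p\<in>cell N. at_node u p)"
    unfolding sum_cell
    using sum_periodic_shift[of "\<lambda>k. u i j k" N for i j] per
    by (simp cong: sum.cong_simp)
qed

section \<open>Diffusion operators with variable coefficients\<close>

definition face_periodic :: "nat \<Rightarrow> face \<Rightarrow> bool" where
  "face_periodic N a \<longleftrightarrow> (case a of (ax, ay, az) \<Rightarrow> ax \<in> V_per N \<and> ay \<in> V_per N \<and> az \<in> V_per N)"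

definition face_positive :: "face \<Rightarrow> bool" where
  "face_positive a \<longleftrightarrow> (case a of (ax, ay, az) \<Rightarrow> \<forall>i j k. ax i j k > 0 \<and> ay i j k > 0 \<and> az i j k > 0)"

text \<open>
  With all coefficients equal to one this is the discrete Laplacian, with the mobility as coefficient it
  is the operator of the scheme.
\<close>

definition diffusion :: "real \<Rightarrow> face \<Rightarrow> grid \<Rightarrow> grid" where
  "diffusion h a u = divergence h (face_times a (grad h u))"

definition diffusion_form :: "real \<Rightarrow> face \<Rightarrow> grid \<Rightarrow> grid \<Rightarrow> grid" where
  "diffusion_form h a u w = (case a of (ax, ay, az) \<Rightarrow> \<lambda>i j k.
     ax i j k * ((u (i + 1) j k - u i j k) / h) * ((w (i + 1) j k - w i j k) / h) +
     ay i j k * ((u i (j + 1) k - u i j k) / h) * ((w i (j + 1) k - w i j k) / h) +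
     az i j k * ((u i j (k + 1) - u i j k) / h) * ((w i j (k + 1) - w i j k) / h))"

lemma diffusion_apply:
  "diffusion h (ax, ay, az) u i j k =
     (ax i j k * ((u (i + 1) j k - u i j k) / h) - ax (i - 1) j k * ((u i j k - u (i - 1) j k) / h)) / h +
     (ay i j k * ((u i (j + 1) k - u i j k) / h) - ay i (j - 1) k * ((u i j k - u i (j - 1) k) / h)) / h +
     (az i j k * ((u i j (k + 1) - u i j k) / h) - az i j (k - 1) * ((u i j k - u i j (k - 1)) / h)) / h"
  by (simp add: diffusion_def divergence_def face_times_def grad_def)

lemma diffusion_linear:
  "diffusion h a (\<lambda>i j k. u i j k + c * w i j k) i j k = diffusion h a u i j k + c * diffusion h a w i j k"
proof (cases a)
  case (fields ax ay az)
  have e: "(x * ((u1 + c * w1 - (u2 + c * w2)) / h) - y * ((u2 + c * w2 - (u3 + c * w3)) / h)) / h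
    = (x * ((u1 - u2) / h) - y * ((u2 - u3) / h)) / h + c * ((x * ((w1 - w2) / h) - y * ((w2 - w3) / h)) / h)"
    for x y u1 u2 u3 w1 w2 w3 :: real
    by (simp add: diff_divide_distrib add_divide_distrib algebra_simps)
  show ?thesis unfolding fields diffusion_apply e by (simp add: algebra_simps)
qed

lemma diffusion_const: "diffusion h a (\<lambda>i j k. c) i j k = 0"
  by (cases a) (simp add: diffusion_apply)

lemma diffusion_sum:
  "diffusion h a (\<lambda>i j k. \<Sum>q\<in>S. c q * e q i j k) i j k = (\<Sum>q\<in>S. c q * diffusion h a (e q) i j k)"
proof (induction S rule: infinite_finite_induct)
  case (insert q S)
  have "diffusion h a (\<lambda>i j k. \<Sum>q\<in>insert q S. c q * e q i j k) i j k
      = diffusion h a (\<lambda>i j k. (\<Sum>q\<in>S. c q * e q i j k) + c q * e q i j k) i j k"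
    using insert.hyps by (simp add: add.commute)
  then show ?case using insert by (simp add: diffusion_linear)
qed (simp_all add: diffusion_const)

lemma V_per_shift:
  assumes "u \<in> V_per N"
  shows "(\<lambda>i j k. u (i + 1) j k) \<in> V_per N" "(\<lambda>i j k. u i (j + 1) k) \<in> V_per N"
    "(\<lambda>i j k. u i j (k + 1)) \<in> V_per N" "(\<lambda>i j k. u (i - 1) j k) \<in> V_per N"
    "(\<lambda>i j k. u i (j - 1) k) \<in> V_per N" "(\<lambda>i j k. u i j (k - 1)) \<in> V_per N"
proof -
  have e: "i + int N + 1 = (i + 1) + int N" "i + int N - 1 = (i - 1) + int N" for i by simp_all
  show "(\<lambda>i j k. u (i + 1) j k) \<in> V_per N" "(\<lambda>i j k. u i (j + 1) k) \<in> V_per N"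
    "(\<lambda>i j k. u i j (k + 1)) \<in> V_per N" "(\<lambda>i j k. u (i - 1) j k) \<in> V_per N"
    "(\<lambda>i j k. u i (j - 1) k) \<in> V_per N" "(\<lambda>i j k. u i j (k - 1)) \<in> V_per N"
    unfolding V_per_def mem_Collect_eq e V_perD[OF assms] by blast+
qed

lemma V_per_arith:
  assumes "u \<in> V_per N" "w \<in> V_per N"
  shows "(\<lambda>i j k. u i j k + w i j k) \<in> V_per N" "(\<lambda>i j k. u i j k - w i j k) \<in> V_per N"
    "(\<lambda>i j k. u i j k * w i j k) \<in> V_per N" "(\<lambda>i j k. u i j k / w i j k) \<in> V_per N"
  unfolding V_per_def mem_Collect_eq V_perD[OF assms(1)] V_perD[OF assms(2)] by blast+

lemma V_per_const: "(\<lambda>i j k. c) \<in> V_per N"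
  by (simp add: V_per_def)

lemma diffusion_V_per:
  assumes a: "face_periodic N a" and u: "u \<in> V_per N"
  shows "diffusion h a u \<in> V_per N"
proof -
  obtain ax ay az where a3: "a = (ax, ay, az)" by (cases a)
  with a have p: "ax \<in> V_per N" "ay \<in> V_per N" "az \<in> V_per N" by (auto simp: face_periodic_def)
  note s = V_per_shift[OF u] V_per_shift[OF p(1)] V_per_shift[OF p(2)] V_per_shift[OF p(3)] u p
  show ?thesis
    unfolding a3 diffusion_apply[abs_def] by (intro V_per_arith V_per_const s)
qed

text \<open>
  In each direction the product rule writes \<open>diffusion h a u * w\<close> as minus the density of the form plus
  the backward difference of a periodic flux, and the latter sums to zero over a period.
\<close>

lemma diffusion_by_parts:
  assumes a: "face_periodic N a" and u: "u \<in> V_per N" and w: "w \<in> V_per N"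
  shows "(\<Sum>p\<in>cell N. at_node (diffusion h a u) p * at_node w p)
       = - (\<Sum>p\<in>cell N. at_node (diffusion_form h a u w) p)"
proof -
  obtain ax ay az where a3: "a = (ax, ay, az)" by (cases a)
  with a have p: "ax \<in> V_per N" "ay \<in> V_per N" "az \<in> V_per N" by (auto simp: face_periodic_def)
  define Fx where "Fx = (\<lambda>i j k. ax i j k * ((u (i + 1) j k - u i j k) / h) * w (i + 1) j k / h)"
  define Fy where "Fy = (\<lambda>i j k. ay i j k * ((u i (j + 1) k - u i j k) / h) * w i (j + 1) k / h)"
  define Fz where "Fz = (\<lambda>i j k. az i j k * ((u i j (k + 1) - u i j k) / h) * w i j (k + 1) / h)"
  note s = V_per_shift[OF u] V_per_shift[OF w] u w p
  have F: "Fx \<in> V_per N" "Fy \<in> V_per N" "Fz \<in> V_per N"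
    unfolding Fx_def Fy_def Fz_def by (intro V_per_arith V_per_const s)+
  have e: "(x * s - y * t) / h * w2 = (x * s * w1 / h - y * t * w2 / h) - x * s * ((w1 - w2) / h)"
    for x y s t w1 w2 :: real
    by (simp add: diff_divide_distrib right_diff_distrib left_diff_distrib)
  have "at_node (diffusion h a u) p * at_node w p
      = (at_node Fx p - at_node (\<lambda>i j k. Fx (i - 1) j k) p)
      + (at_node Fy p - at_node (\<lambda>i j k. Fy i (j - 1) k) p)
      + (at_node Fz p - at_node (\<lambda>i j k. Fz i j (k - 1)) p)
      - at_node (diffusion_form h a u w) p" for p
  proof (cases p)
    case (fields i j k)
    show ?thesis
      unfolding fields a3 at_node_simp diffusion_apply diffusion_form_def prod.case distrib_right
        e[of "ax i j k" _ _ _ _ "w (i + 1) j k"] e[of "ay i j k" _ _ _ _ "w i (j + 1) k"]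
        e[of "az i j k" _ _ _ _ "w i j (k + 1)"] Fx_def Fy_def Fz_def
      by simp
  qed
  then have "(\<Sum>p\<in>cell N. at_node (diffusion h a u) p * at_node w p)
     = (\<Sum>p\<in>cell N. (at_node Fx p - at_node (\<lambda>i j k. Fx (i - 1) j k) p)
      + (at_node Fy p - at_node (\<lambda>i j k. Fy i (j - 1) k) p)
      + (at_node Fz p - at_node (\<lambda>i j k. Fz i j (k - 1)) p)
      - at_node (diffusion_form h a u w) p)" by simp
  also have "\<dots> = - (\<Sum>p\<in>cell N. at_node (diffusion_form h a u w) p)"
    using sum_cell_shift(1)[OF F(1)] sum_cell_shift(2)[OF F(2)] sum_cell_shift(3)[OF F(3)]
    by (simp add: sum.distrib sum_subtractf)
  finally show ?thesis .
qed

lemma diffusion_form_sym: "diffusion_form h a u w = diffusion_form h a w u"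
  by (cases a) (simp add: diffusion_form_def mult_ac)

lemma diffusion_form_square:
  "diffusion_form h (ax, ay, az) u u i j k =
     ax i j k * ((u (i + 1) j k - u i j k) / h)\<^sup>2 + ay i j k * ((u i (j + 1) k - u i j k) / h)\<^sup>2
     + az i j k * ((u i j (k + 1) - u i j k) / h)\<^sup>2"
  by (simp only: diffusion_form_def prod.case power2_eq_square mult.assoc)

lemma diffusion_form_nonneg:
  assumes "face_positive a"
  shows "diffusion_form h a u u i j k \<ge> 0"
proof (cases a)
  case (fields ax ay az)
  then have "ax i j k \<ge> 0" "ay i j k \<ge> 0" "az i j k \<ge> 0"
    using assms by (auto simp: face_positive_def less_imp_le)
  then show ?thesis unfolding fields diffusion_form_square by simp
qed

text \<open>
  Summation by parts against \<open>u\<close> itself shows that all differences between neighbouring cells vanish, and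
  any two cells are joined by a chain of neighbours.
\<close>

lemma diffusion_kernel:
  assumes N: "N \<ge> 1" and h: "h \<noteq> 0" and a: "face_periodic N a" "face_positive a"
    and u: "u \<in> V_per N" and z: "\<And>p. p \<in> cell N \<Longrightarrow> at_node (diffusion h a u) p = 0"
  shows "u i j k = u 0 0 0"
proof -
  obtain ax ay az where a3: "a = (ax, ay, az)" by (cases a)
  with a(2) have pos: "ax i j k > 0" "ay i j k > 0" "az i j k > 0" for i j k
    by (auto simp: face_positive_def)
  have "(\<Sum>p\<in>cell N. at_node (diffusion_form h a u u) p) = 0"
    using diffusion_by_parts[OF a(1) u u, of h] z by simp
  moreover have "at_node (diffusion_form h a u u) p \<ge> 0" for p
    using diffusion_form_nonneg[OF a(2)] by (cases p) simp
  ultimately have form: "at_node (diffusion_form h a u u) p = 0" if "p \<in> cell N" for p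
    using that by (simp add: sum_nonneg_eq_0_iff)
  have nodes: "u (i + 1) j k = u i j k \<and> u i (j + 1) k = u i j k \<and> u i j (k + 1) = u i j k"
    if "(i, j, k) \<in> cell N" for i j k
  proof -
    have "ax i j k * ((u (i + 1) j k - u i j k) / h)\<^sup>2 + ay i j k * ((u i (j + 1) k - u i j k) / h)\<^sup>2
        + az i j k * ((u i j (k + 1) - u i j k) / h)\<^sup>2 = 0"
      using form[OF that] unfolding a3 at_node_simp diffusion_form_square .
    moreover have "0 \<le> ax i j k * ((u (i + 1) j k - u i j k) / h)\<^sup>2"
      "0 \<le> ay i j k * ((u i (j + 1) k - u i j k) / h)\<^sup>2"
      "0 \<le> az i j k * ((u i j (k + 1) - u i j k) / h)\<^sup>2"
      using pos[of i j k] by simp_all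
    ultimately have "ax i j k * ((u (i + 1) j k - u i j k) / h)\<^sup>2 = 0"
      "ay i j k * ((u i (j + 1) k - u i j k) / h)\<^sup>2 = 0"
      "az i j k * ((u i j (k + 1) - u i j k) / h)\<^sup>2 = 0" by linarith+
    then show ?thesis using pos[of i j k] h by simp
  qed
  have "(\<lambda>i j k. u (i + 1) j k) = u"
    by (rule V_per_eqI[OF N V_per_shift(1)[OF u] u]) (clarsimp simp: nodes)
  moreover have "(\<lambda>i j k. u i (j + 1) k) = u"
    by (rule V_per_eqI[OF N V_per_shift(2)[OF u] u]) (clarsimp simp: nodes)
  moreover have "(\<lambda>i j k. u i j (k + 1)) = u"
    by (rule V_per_eqI[OF N V_per_shift(3)[OF u] u]) (clarsimp simp: nodes)
  ultimately have step: "u (i + 1) j k = u i j k" "u i (j + 1) k = u i j k" "u i j (k + 1) = u i j k"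
    for i j k by (simp_all add: fun_eq_iff)
  have "u (0 + 1 * i) j k = u 0 j k"
    by (rule periodic_add_multiple[where f = "\<lambda>i. u i j k"]) (rule step)
  moreover have "u 0 (0 + 1 * j) k = u 0 0 k"
    by (rule periodic_add_multiple[where f = "\<lambda>j. u 0 j k"]) (rule step)
  moreover have "u 0 0 (0 + 1 * k) = u 0 0 0"
    by (rule periodic_add_multiple[where f = "\<lambda>k. u 0 0 k"]) (rule step)
  ultimately show ?thesis by simp
qed

definition diffusion_matrix :: "nat \<Rightarrow> real \<Rightarrow> face \<Rightarrow> int \<times> int \<times> int \<Rightarrow> int \<times> int \<times> int \<Rightarrow> real" where
  "diffusion_matrix N h a p q = at_node (diffusion h a (periodic_ext N (\<lambda>s. if s = q then 1 else 0))) p"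

lemma diffusion_matrix_mult:
  assumes N: "N \<ge> 1" and u: "u \<in> V_per N"
  shows "at_node (diffusion h a u) p = (\<Sum>q\<in>cell N. diffusion_matrix N h a p q * at_node u q)"
proof -
  have "u = (\<lambda>i j k. \<Sum>q\<in>cell N. at_node u q * periodic_ext N (\<lambda>s. if s = q then 1 else 0) i j k)"
  proof (intro ext)
    fix i j k
    have "(\<Sum>q\<in>cell N. at_node u q * periodic_ext N (\<lambda>s. if s = q then 1 else 0) i j k)
        = (\<Sum>q\<in>cell N. if q = (wrap N i, wrap N j, wrap N k) then at_node u q else 0)"
      by (intro sum.cong) (auto simp: periodic_ext_def)
    also have "\<dots> = u i j k"
      using wrap_in_cell[OF N] by (simp add: V_per_wrap[OF u])
    finally show "u i j k = (\<Sum>q\<in>cell N. at_node u q * periodic_ext N (\<lambda>s. if s = q then 1 else 0) i j k)" ..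
  qed
  then have "diffusion h a u = (\<lambda>i j k. \<Sum>q\<in>cell N. at_node u q * diffusion h a (periodic_ext N (\<lambda>s. if s = q then 1 else 0)) i j k)"
    by (intro ext) (metis (no_types) diffusion_sum)
  then show ?thesis by (cases p) (simp add: diffusion_matrix_def mult.commute)
qed

lemma diffusion_matrix_sym:
  assumes a: "face_periodic N a" and "p \<in> cell N" "q \<in> cell N"
  shows "diffusion_matrix N h a p q = diffusion_matrix N h a q p"
proof -
  let ?\<delta> = "\<lambda>q. periodic_ext N (\<lambda>s. if s = q then 1 else 0)"
  have *: "diffusion_matrix N h a p q = - (\<Sum>s\<in>cell N. at_node (diffusion_form h a (?\<delta> q) (?\<delta> p)) s)"
    if "p \<in> cell N" for p q
  proof -
    have "diffusion_matrix N h a p q = (\<Sum>s\<in>cell N. if s = p then at_node (diffusion h a (?\<delta> q)) s else 0)"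
      using that by (simp add: diffusion_matrix_def)
    also have "\<dots> = (\<Sum>s\<in>cell N. at_node (diffusion h a (?\<delta> q)) s * at_node (?\<delta> p) s)"
      by (intro sum.cong) auto
    finally show ?thesis unfolding diffusion_by_parts[OF a periodic_ext_V_per periodic_ext_V_per] .
  qed
  show ?thesis using assms *[of p q] *[of q p] diffusion_form_sym[of h a "?\<delta> q" "?\<delta> p"] by simp
qed

text \<open>
  The matrix of \<open>- diffusion h a\<close> is symmetric by summation by parts, and its kernel consists of the
  constants.
\<close>

lemma diffusion_green_matrix:
  assumes N: "N \<ge> 1" and h: "h \<noteq> 0" and a: "face_periodic N a" "face_positive a"
  obtains R where "\<And>p q. p \<in> cell N \<Longrightarrow> q \<in> cell N \<Longrightarrow> R p q = R q p"
    and "\<And>x i j k. (\<Sum>p\<in>cell N. x p) = 0 \<Longrightarrow>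
          - diffusion h a (periodic_ext N (\<lambda>p. \<Sum>q\<in>cell N. R p q * x q)) i j k = periodic_ext N x i j k"
    and "\<And>x. (\<Sum>p\<in>cell N. x p) = 0 \<Longrightarrow> (\<Sum>p\<in>cell N. \<Sum>q\<in>cell N. R p q * x q) = 0"
proof -
  define A where "A = (\<lambda>p q. - diffusion_matrix N h a p q)"
  have mult: "(\<Sum>q\<in>cell N. A p q * x q) = - at_node (diffusion h a (periodic_ext N x)) p" for p x
    using diffusion_matrix_mult[OF N, of "periodic_ext N x" h a p] by (simp add: A_def sum_negf)
  have one: "periodic_ext N (\<lambda>_. 1) = (\<lambda>i j k. 1)" by (simp add: periodic_ext_def)
  obtain R where R: "\<And>p q. p \<in> cell N \<Longrightarrow> q \<in> cell N \<Longrightarrow> R p q = R q p"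
    and AR: "\<And>g p. (\<Sum>q\<in>cell N. g q) = 0 \<Longrightarrow> p \<in> cell N \<Longrightarrow>
           (\<Sum>q\<in>cell N. A p q * (\<Sum>s\<in>cell N. R q s * g s)) = g p"
    and R0: "\<And>g. (\<Sum>q\<in>cell N. g q) = 0 \<Longrightarrow> (\<Sum>p\<in>cell N. \<Sum>q\<in>cell N. R p q * g q) = 0"
  proof (rule green_matrix_exists[of "cell N" A])
    show "A p q = A q p" if "p \<in> cell N" "q \<in> cell N" for p q
      using diffusion_matrix_sym[OF a(1) that] by (simp add: A_def)
    show "(\<Sum>q\<in>cell N. A p q) = 0" for p
      using mult[of p "\<lambda>_. 1"] one by (cases p) (simp add: diffusion_const)
    show "x p = x q" if "\<forall>p\<in>cell N. (\<Sum>q\<in>cell N. A p q * x q) = 0" "p \<in> cell N" "q \<in> cell N" for x p q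
    proof -
      have "periodic_ext N x i j k = periodic_ext N x 0 0 0" for i j k
        using that(1) by (intro diffusion_kernel[OF N h a]) (auto simp: mult)
      then have "at_node (periodic_ext N x) p = at_node (periodic_ext N x) q"
        by (cases p, cases q) (metis at_node_simp)
      then show ?thesis using that by simp
    qed
  qed (use cell_nonempty[OF N] in auto)
  show thesis
  proof
    fix x :: "int \<times> int \<times> int \<Rightarrow> real" and i j k :: int
    assume x: "(\<Sum>p\<in>cell N. x p) = 0"
    let ?y = "periodic_ext N (\<lambda>p. \<Sum>q\<in>cell N. R p q * x q)"
    have "(\<lambda>i j k. - diffusion h a ?y i j k) = periodic_ext N x"
    proof (rule V_per_eqI[OF N])
      show "(\<lambda>i j k. - diffusion h a ?y i j k) \<in> V_per N"
        using diffusion_V_per[OF a(1) periodic_ext_V_per] by (simp add: V_per_def)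
      fix p assume "p \<in> cell N"
      then show "at_node (\<lambda>i j k. - diffusion h a ?y i j k) p = at_node (periodic_ext N x) p"
        using AR[OF x, of p] mult[of p "\<lambda>p. \<Sum>q\<in>cell N. R p q * x q"]
          periodic_ext_cell[of p N x] by (cases p) (simp del: periodic_ext_cell)
    qed simp
    then show "- diffusion h a ?y i j k = periodic_ext N x i j k" by (simp add: fun_eq_iff)
  qed (use R R0 in auto)
qed

section \<open>The mobility and the inverse Laplacian\<close>

definition unit_face :: face where
  "unit_face = ((\<lambda>i j k. 1), (\<lambda>i j k. 1), (\<lambda>i j k. 1))"

lemma unit_face_periodic: "face_periodic N unit_face" and unit_face_positive: "face_positive unit_face"
  by (simp_all add: unit_face_def face_periodic_def face_positive_def V_per_const)

lemma laplacian_eq_diffusion: "laplacian h u = diffusion h unit_face u"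
  by (simp add: laplacian_def diffusion_def unit_face_def face_times_def grad_def)

lemma mobility_face_periodic:
  assumes "v \<in> V_per N" "w \<in> V_per N"
  shows "face_periodic N (mobility_face M \<tau> v w)"
proof -
  let ?m = "\<lambda>i j k. 3 / 2 * M (v i j k) - 1 / 2 * M (w i j k)"
  have m: "?m \<in> V_per N"
    unfolding V_per_def mem_Collect_eq V_perD[OF assms(1)] V_perD[OF assms(2)] by blast
  have map: "(\<lambda>i j k. F (u i j k)) \<in> V_per N" if "u \<in> V_per N" for F :: "real \<Rightarrow> real" and u
    unfolding V_per_def mem_Collect_eq V_perD[OF that] by blast
  have "(\<lambda>i j k. (?m (i + 1) j k + ?m i j k) / 2) \<in> V_per N"
    "(\<lambda>i j k. (?m i (j + 1) k + ?m i j k) / 2) \<in> V_per N"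
    "(\<lambda>i j k. (?m i j (k + 1) + ?m i j k) / 2) \<in> V_per N"
    by (intro V_per_arith V_per_const m V_per_shift[OF m])+
  from this[THEN map, of "\<lambda>a. sqrt (a\<^sup>2 + \<tau> ^ 6)"] show ?thesis
    by (simp only: face_periodic_def mobility_face_def face_map_def avg_face_def prod.case simp_thms)
qed

text \<open>
  The regularisation \<open>\<tau> ^ 6\<close> under the root keeps the mobility on the faces positive even where the
  extrapolated mobility vanishes or changes sign.
\<close>

lemma mobility_face_positive: "\<tau> > 0 \<Longrightarrow> face_positive (mobility_face M \<tau> v w)"
  by (simp add: face_positive_def mobility_face_def face_map_def avg_face_def add_nonneg_pos)

lemma V0_per_iff:
  assumes "L > 0" "N \<ge> 1"
  shows "u \<in> V0_per L N \<longleftrightarrow> u \<in> V_per N \<and> (\<Sum>p\<in>cell N. at_node u p) = 0"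
  using assms by (simp add: V0_per_def mean_eq)

lemma at_node_eqs:
  "at_node (\<lambda>i j k. c) p = c"
  "at_node (\<lambda>i j k. u i j k + w i j k) p = at_node u p + at_node w p"
  "at_node (\<lambda>i j k. u i j k - w i j k) p = at_node u p - at_node w p"
  "at_node (\<lambda>i j k. u i j k / c) p = at_node u p / c"
  by (cases p; simp)+

lemma mean_midpoint:
  assumes "L > 0" "N \<ge> 1"
  shows "mean L N (\<lambda>i j k. (u i j k + v i j k) / 2) = (mean L N u + mean L N v) / 2"
  using assms by (simp add: mean_eq at_node_eqs sum.distrib add_divide_distrib flip: sum_divide_distrib)

lemma minus_mean_V0_per_iff:
  assumes "L > 0" "N \<ge> 1"
  shows "(\<lambda>i j k. u i j k - c) \<in> V0_per L N \<longleftrightarrow> u \<in> V_per N \<and> mean L N u = c"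
proof -
  have "(\<lambda>i j k. u i j k - c) \<in> V_per N \<longleftrightarrow> u \<in> V_per N" by (simp add: V_per_def)
  moreover have "(\<Sum>p\<in>cell N. at_node (\<lambda>i j k. u i j k - c) p) = (\<Sum>p\<in>cell N. at_node u p) - real N ^ 3 * c"
    by (simp add: at_node_eqs sum_subtractf)
  moreover have "mean L N u = c \<longleftrightarrow> (\<Sum>p\<in>cell N. at_node u p) - real N ^ 3 * c = 0"
    using assms by (simp add: mean_eq divide_eq_eq mult.commute)
  ultimately show ?thesis using assms by (simp add: V0_per_iff)
qed

lemma inv_neg_laplacian_eqI:
  assumes L: "L > 0" and N: "N \<ge> 1" and w: "w \<in> V0_per L N"
    and eq: "\<And>i j k. - laplacian (spacing L N) w i j k = g i j k"
  shows "inv_neg_laplacian L N g = w"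
  unfolding inv_neg_laplacian_def
proof (rule inv_into_f_eq[OF _ w])
  have h: "spacing L N \<noteq> 0" using L N by (simp add: spacing_def)
  show "inj_on (\<lambda>u i j k. - laplacian (spacing L N) u i j k) (V0_per L N)"
  proof (rule inj_onI)
    fix u1 u2 assume u: "u1 \<in> V0_per L N" "u2 \<in> V0_per L N"
      and e: "(\<lambda>i j k. - laplacian (spacing L N) u1 i j k) = (\<lambda>i j k. - laplacian (spacing L N) u2 i j k)"
    from u have u1: "u1 \<in> V_per N" "(\<Sum>p\<in>cell N. at_node u1 p) = 0"
      and u2: "u2 \<in> V_per N" "(\<Sum>p\<in>cell N. at_node u2 p) = 0"
      by (simp_all add: V0_per_iff[OF L N])
    define d where "d = (\<lambda>i j k. u1 i j k + (- 1) * u2 i j k)"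
    have dV: "d \<in> V_per N" unfolding d_def by (intro V_per_arith V_per_const u1 u2)
    have "diffusion (spacing L N) unit_face d i j k = 0" for i j k
      using e unfolding d_def diffusion_linear by (simp add: laplacian_eq_diffusion fun_eq_iff)
    then have const: "d i j k = d 0 0 0" for i j k
      by (intro diffusion_kernel[OF N h unit_face_periodic unit_face_positive dV]) (auto simp: at_node_def)
    have "(\<Sum>p\<in>cell N. at_node d p) = (\<Sum>p\<in>cell N. at_node u1 p - at_node u2 p)"
      by (intro sum.cong) (auto simp: d_def)
    also have "\<dots> = 0" using u1 u2 by (simp add: sum_subtractf)
    also have "(\<Sum>p\<in>cell N. at_node d p) = (\<Sum>p\<in>cell N. d 0 0 0)"
      by (rule sum.cong[OF refl]) (metis at_node_simp const surj_pair)
    finally have "d 0 0 0 = 0" using N by simp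
    then show "u1 = u2" using const by (simp add: d_def fun_eq_iff)
  qed
  show "(\<lambda>i j k. - laplacian (spacing L N) w i j k) = g" using eq by (simp add: fun_eq_iff)
qed

lemma inv_neg_laplacian_solves:
  assumes L: "L > 0" and N: "N \<ge> 1" and g: "g \<in> V0_per L N"
  shows "inv_neg_laplacian L N g \<in> V0_per L N"
    and "- laplacian (spacing L N) (inv_neg_laplacian L N g) i j k = g i j k"
proof -
  have h: "spacing L N \<noteq> 0" using L N by (simp add: spacing_def)
  from g have gV: "g \<in> V_per N" and g0: "(\<Sum>p\<in>cell N. at_node g p) = 0"
    by (simp_all add: V0_per_iff[OF L N])
  obtain R where Rsym: "\<And>p q. p \<in> cell N \<Longrightarrow> q \<in> cell N \<Longrightarrow> R p q = R q p"
    and R: "\<And>x i j k. (\<Sum>p\<in>cell N. x p) = 0 \<Longrightarrow>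
          - diffusion (spacing L N) unit_face (periodic_ext N (\<lambda>p. \<Sum>q\<in>cell N. R p q * x q)) i j k = periodic_ext N x i j k"
    and R0: "\<And>x. (\<Sum>p\<in>cell N. x p) = 0 \<Longrightarrow> (\<Sum>p\<in>cell N. \<Sum>q\<in>cell N. R p q * x q) = 0"
    by (rule diffusion_green_matrix[OF N h unit_face_periodic unit_face_positive]) (rule that)
  define w where "w = periodic_ext N (\<lambda>p. \<Sum>q\<in>cell N. R p q * at_node g q)"
  have w0: "w \<in> V0_per L N"
    using R0[OF g0] by (simp add: w_def V0_per_iff[OF L N])
  have weq: "- laplacian (spacing L N) w i j k = g i j k" for i j k
    using R[OF g0, of i j k] by (simp add: w_def laplacian_eq_diffusion periodic_ext_at_node[OF gV])
  have "inv_neg_laplacian L N g = w" by (rule inv_neg_laplacian_eqI[OF L N w0 weq])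
  with w0 weq show "inv_neg_laplacian L N g \<in> V0_per L N"
    "- laplacian (spacing L N) (inv_neg_laplacian L N g) i j k = g i j k" by simp_all
qed

section \<open>Unique solvability\<close>

text \<open>
  This separates the pointwise nonlinearity in the unknown \<open>u\<close> from the terms that are affine in \<open>u\<close>.
\<close>

lemma mu_h_eq:
  "mu_h L N \<theta>0 \<epsilon> \<sigma> \<tau> u v w i j k =
     site_potential \<tau> (v i j k) (u i j k) - \<theta>0 * (3 / 2 * v i j k - 1 / 2 * w i j k)
     - \<epsilon>\<^sup>2 * (3 / 4 * diffusion (spacing L N) unit_face u i j k + 1 / 4 * diffusion (spacing L N) unit_face w i j k)
     + \<sigma> * inv_neg_laplacian L N
        (\<lambda>a b c. (u a b c + v a b c) / 2 - mean L N (\<lambda>a b c. (u a b c + v a b c) / 2)) i j k"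
proof -
  let ?h = "spacing L N"
  have "diffusion ?h unit_face (\<lambda>a b c. 3 / 4 * u a b c) i j k = 3 / 4 * diffusion ?h unit_face u i j k"
    using diffusion_linear[of ?h unit_face "\<lambda>_ _ _. 0" "3 / 4" u i j k] by (simp add: diffusion_const)
  then have "diffusion ?h unit_face (\<lambda>a b c. 3 / 4 * u a b c + 1 / 4 * w a b c) i j k
      = 3 / 4 * diffusion ?h unit_face u i j k + 1 / 4 * diffusion ?h unit_face w i j k"
    by (simp only: diffusion_linear)
  then show ?thesis
    by (simp only: mu_h_def site_potential_def laplacian_eq_diffusion)
qed

lemma mu_h_V_per:
  assumes L: "L > 0" and N: "N \<ge> 1" and u: "u \<in> V_per N" and v: "v \<in> V_per N" and w: "w \<in> V_per N"
  shows "mu_h L N \<theta>0 \<epsilon> \<sigma> \<tau> u v w \<in> V_per N"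
proof -
  let ?g = "\<lambda>a b c. (u a b c + v a b c) / 2 - mean L N (\<lambda>a b c. (u a b c + v a b c) / 2)"
  have "?g \<in> V0_per L N"
    by (simp only: minus_mean_V0_per_iff[OF L N] simp_thms) (intro V_per_arith V_per_const u v)
  then have S: "inv_neg_laplacian L N ?g \<in> V_per N"
    using inv_neg_laplacian_solves(1)[OF L N] by (simp add: V0_per_def)
  have F: "(\<lambda>i j k. F (u i j k) (v i j k)) \<in> V_per N" for F :: "real \<Rightarrow> real \<Rightarrow> real"
    unfolding V_per_def mem_Collect_eq V_perD[OF u] V_perD[OF v] by blast
  show ?thesis
    unfolding mu_h_eq[abs_def]
    by (intro V_per_arith(1)[of _ N] V_per_arith(2)[of _ N] V_per_arith(3)[of _ N] V_per_const
        diffusion_V_per[OF unit_face_periodic] u v w S F[of "\<lambda>x y. site_potential \<tau> y x"])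
qed

text \<open>
  For the difference \<open>d\<close> of two solutions and the difference \<open>e\<close> of their chemical potentials, the scheme
  gives \<open>d = \<tau> * diffusion h a e\<close>, so the inner product of \<open>d\<close> and \<open>e\<close> is nonpositive. On the other hand
  \<open>e\<close> is the sum of a strictly increasing function of the solution at each cell and of positive
  semidefinite operators applied to \<open>d\<close>, so the inner product is positive unless \<open>d = 0\<close>.
\<close>

lemma scheme_solution_unique:
  assumes L: "L > 0" and N: "N \<ge> 1" and \<sigma>: "\<sigma> \<ge> 0" and \<tau>: "\<tau> > 0"
    and a: "face_periodic N a" "face_positive a"
    and v: "v \<in> V_per N" and w: "w \<in> V_per N" and vn: "norm_inf N v < 1"
    and \<phi>: "\<phi> \<in> V_per N" "norm_inf N \<phi> < 1" and \<psi>: "\<psi> \<in> V_per N" "norm_inf N \<psi> < 1"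
    and means: "mean L N \<phi> = mean L N \<psi>"
    and \<phi>eq: "\<And>i j k. (\<phi> i j k - v i j k) / \<tau> = diffusion (spacing L N) a (mu_h L N \<theta>0 \<epsilon> \<sigma> \<tau> \<phi> v w) i j k"
    and \<psi>eq: "\<And>i j k. (\<psi> i j k - v i j k) / \<tau> = diffusion (spacing L N) a (mu_h L N \<theta>0 \<epsilon> \<sigma> \<tau> \<psi> v w) i j k"
  shows "\<phi> = \<psi>"
proof -
  let ?h = "spacing L N"
  let ?\<mu> = "\<lambda>u. mu_h L N \<theta>0 \<epsilon> \<sigma> \<tau> u v w"
  let ?g = "\<lambda>u a b c. (u a b c + v a b c) / 2 - mean L N (\<lambda>a b c. (u a b c + v a b c) / 2)"
  let ?S = "\<lambda>u. inv_neg_laplacian L N (?g u)"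
  have g0: "?g u \<in> V0_per L N" if "u \<in> V_per N" for u
    by (simp only: minus_mean_V0_per_iff[OF L N] simp_thms) (intro V_per_arith V_per_const v that)
  define d where "d = (\<lambda>i j k. \<phi> i j k + (- 1) * \<psi> i j k)"
  define e where "e = (\<lambda>i j k. ?\<mu> \<phi> i j k + (- 1) * ?\<mu> \<psi> i j k)"
  define s where "s = (\<lambda>i j k. ?S \<phi> i j k + (- 1) * ?S \<psi> i j k)"
  have SV: "?S \<phi> \<in> V_per N" "?S \<psi> \<in> V_per N"
    using inv_neg_laplacian_solves(1)[OF L N g0] \<phi>(1) \<psi>(1) by (simp_all add: V0_per_def)
  have dV: "d \<in> V_per N" unfolding d_def by (intro V_per_arith V_per_const \<phi> \<psi>)
  have eV: "e \<in> V_per N" unfolding e_def by (intro V_per_arith V_per_const mu_h_V_per L N \<phi> \<psi> v w)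
  have sV: "s \<in> V_per N" unfolding s_def by (intro V_per_arith V_per_const SV)
  have de: "d i j k = \<tau> * diffusion ?h a e i j k" for i j k
  proof -
    have "diffusion ?h a e i j k = (\<phi> i j k - v i j k) / \<tau> - (\<psi> i j k - v i j k) / \<tau>"
      unfolding e_def diffusion_linear \<phi>eq \<psi>eq by simp
    then show ?thesis using \<tau> by (simp add: d_def field_simps)
  qed
  have ds: "d i j k = - 2 * diffusion ?h unit_face s i j k" for i j k
  proof -
    have "- diffusion ?h unit_face s i j k = ?g \<phi> i j k - ?g \<psi> i j k"
      using inv_neg_laplacian_solves(2)[OF L N g0[OF \<phi>(1)], of i j k]
        inv_neg_laplacian_solves(2)[OF L N g0[OF \<psi>(1)], of i j k]
      unfolding s_def diffusion_linear laplacian_eq_diffusion by linarith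
    also have "\<dots> = d i j k / 2" using means by (simp add: d_def mean_midpoint[OF L N] field_simps)
    finally show ?thesis by simp
  qed
  let ?D = "\<lambda>p. site_potential \<tau> (at_node v p) (at_node \<phi> p) - site_potential \<tau> (at_node v p) (at_node \<psi> p)"
  have e_eq: "at_node e p = ?D p - 3 / 4 * \<epsilon>\<^sup>2 * at_node (diffusion ?h unit_face d) p + \<sigma> * at_node s p" for p
  proof (cases p)
    case (fields i j k)
    have lap: "diffusion ?h unit_face d i j k = diffusion ?h unit_face \<phi> i j k - diffusion ?h unit_face \<psi> i j k"
      unfolding d_def diffusion_linear by simp
    show ?thesis unfolding fields at_node_simp e_def s_def mu_h_eq lap by (simp add: algebra_simps)
  qed
  have "(\<Sum>p\<in>cell N. at_node d p * at_node e p) = \<tau> * (\<Sum>p\<in>cell N. at_node (diffusion ?h a e) p * at_node e p)"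
    unfolding sum_distrib_left by (intro sum.cong) (auto simp: de)
  also have "\<dots> \<le> 0"
    unfolding diffusion_by_parts[OF a(1) eV eV] using \<tau> diffusion_form_nonneg[OF a(2)]
    by (auto intro!: mult_nonneg_nonneg sum_nonneg)
  finally have de_le: "(\<Sum>p\<in>cell N. at_node d p * at_node e p) \<le> 0" .
  have d_lap: "(\<Sum>p\<in>cell N. at_node (diffusion ?h unit_face d) p * at_node d p) \<le> 0"
    unfolding diffusion_by_parts[OF unit_face_periodic dV dV] using diffusion_form_nonneg[OF unit_face_positive]
    by (auto intro!: sum_nonneg)
  have "(\<Sum>p\<in>cell N. at_node d p * at_node s p) = - 2 * (\<Sum>p\<in>cell N. at_node (diffusion ?h unit_face s) p * at_node s p)"
    unfolding sum_distrib_left by (intro sum.cong) (auto simp: ds)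
  also have "\<dots> \<ge> 0"
    unfolding diffusion_by_parts[OF unit_face_periodic sV sV] using diffusion_form_nonneg[OF unit_face_positive]
    by (auto intro!: sum_nonneg)
  finally have ds_ge: "(\<Sum>p\<in>cell N. at_node d p * at_node s p) \<ge> 0" .
  have "(\<Sum>p\<in>cell N. at_node d p * at_node e p)
     = (\<Sum>p\<in>cell N. at_node d p * ?D p - 3 / 4 * \<epsilon>\<^sup>2 * (at_node (diffusion ?h unit_face d) p * at_node d p)
         + \<sigma> * (at_node d p * at_node s p))"
    by (intro sum.cong) (auto simp: e_eq algebra_simps)
  also have "\<dots> = (\<Sum>p\<in>cell N. at_node d p * ?D p)
     - 3 / 4 * \<epsilon>\<^sup>2 * (\<Sum>p\<in>cell N. at_node (diffusion ?h unit_face d) p * at_node d p)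
     + \<sigma> * (\<Sum>p\<in>cell N. at_node d p * at_node s p)"
    by (simp add: sum.distrib sum_subtractf sum_distrib_left)
  finally have "(\<Sum>p\<in>cell N. at_node d p * ?D p) \<le> 0"
    using de_le mult_nonneg_nonneg[OF \<sigma> ds_ge] mult_nonneg_nonpos[OF _ d_lap, of "3 / 4 * \<epsilon>\<^sup>2"] by simp
  have range: "at_node v p \<in> {-1<..<1}" "at_node \<phi> p \<in> {-1<..<1}" "at_node \<psi> p \<in> {-1<..<1}"
    if "p \<in> cell N" for p
    using that vn \<phi>(2) \<psi>(2) unfolding norm_inf_less_iff[OF N] by (auto simp: abs_less_iff)
  have dD: "at_node d p * ?D p \<ge> 0 \<and> (at_node d p \<noteq> 0 \<longrightarrow> at_node d p * ?D p > 0)"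
    if p: "p \<in> cell N" for p
  proof -
    have dp: "at_node d p = at_node \<phi> p - at_node \<psi> p" by (cases p) (simp add: d_def)
    note mono = strict_mono_onD[OF site_potential_strict_mono[OF range(1)[OF p] \<tau>]]
    consider "at_node \<phi> p < at_node \<psi> p" | "at_node \<phi> p = at_node \<psi> p" | "at_node \<psi> p < at_node \<phi> p" by linarith
    then show ?thesis
    proof cases
      case 1
      then show ?thesis using mono[OF range(2,3)[OF p] 1] by (simp add: dp mult_neg_neg less_imp_le)
    next
      case 3
      then show ?thesis using mono[OF range(3,2)[OF p] 3] by (simp add: dp less_imp_le)
    qed (simp add: dp)
  qed
  have "(\<Sum>p\<in>cell N. at_node d p * ?D p) = 0"
    using \<open>(\<Sum>p\<in>cell N. at_node d p * ?D p) \<le> 0\<close> dD by (intro antisym sum_nonneg) auto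
  then have dD0: "at_node d p * ?D p = 0" if "p \<in> cell N" for p
    using dD that by (simp add: sum_nonneg_eq_0_iff)
  then have d0: "at_node d p = 0" if "p \<in> cell N" for p
    using dD[OF that] dD0[OF that] by (metis less_irrefl)
  show ?thesis
  proof (rule V_per_eqI[OF N \<phi>(1) \<psi>(1)])
    fix p assume "p \<in> cell N"
    from d0[OF this] show "at_node \<phi> p = at_node \<psi> p" by (cases p) (simp add: d_def)
  qed
qed

text \<open>
  Let \<open>R\<close> and \<open>S\<close> invert \<open>- diffusion h a\<close> and the negative Laplacian on the functions of mean zero. The
  scheme says that the chemical potential plus \<open>R (\<phi> - v) / \<tau>\<close> lies in the kernel of \<open>diffusion h a\<close>, that
  is, equals a constant \<open>c\<close>. In the values of \<open>\<phi>\<close> on one period this is the system solved by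
  \<open>constrained_critical_point\<close>, with a symmetric matrix \<open>B\<close>.
\<close>

lemma scheme_solution_exists:
  assumes L: "L > 0" and N: "N \<ge> 1" and \<tau>: "\<tau> > 0"
    and a: "face_periodic N a" "face_positive a"
    and v: "v \<in> V_per N" and w: "w \<in> V_per N" and vn: "norm_inf N v < 1" and m: "\<bar>mean L N v\<bar> < 1"
  shows "\<exists>\<phi>\<in>V_per N. norm_inf N \<phi> < 1 \<and> mean L N \<phi> = mean L N v
    \<and> (\<forall>i j k. (\<phi> i j k - v i j k) / \<tau> = diffusion (spacing L N) a (mu_h L N \<theta>0 \<epsilon> \<sigma> \<tau> \<phi> v w) i j k)"
proof -
  let ?h = "spacing L N"
  define m where "m = mean L N v"
  have h: "?h \<noteq> 0" using L N by (simp add: spacing_def)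
  have N3: "real N ^ 3 > 0" using N by simp
  have vsum: "(\<Sum>p\<in>cell N. at_node v p) = real N ^ 3 * m"
    using N3 by (simp add: m_def mean_eq[OF L N])
  obtain R where Rsym: "\<And>p q. p \<in> cell N \<Longrightarrow> q \<in> cell N \<Longrightarrow> R p q = R q p"
    and R: "\<And>x i j k. (\<Sum>p\<in>cell N. x p) = 0 \<Longrightarrow>
          - diffusion ?h a (periodic_ext N (\<lambda>p. \<Sum>q\<in>cell N. R p q * x q)) i j k = periodic_ext N x i j k"
    and R0: "\<And>x. (\<Sum>p\<in>cell N. x p) = 0 \<Longrightarrow> (\<Sum>p\<in>cell N. \<Sum>q\<in>cell N. R p q * x q) = 0"
    by (rule diffusion_green_matrix[OF N h a]) (rule that)
  obtain S where Ssym: "\<And>p q. p \<in> cell N \<Longrightarrow> q \<in> cell N \<Longrightarrow> S p q = S q p"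
    and S: "\<And>x i j k. (\<Sum>p\<in>cell N. x p) = 0 \<Longrightarrow>
          - diffusion ?h unit_face (periodic_ext N (\<lambda>p. \<Sum>q\<in>cell N. S p q * x q)) i j k = periodic_ext N x i j k"
    and S0: "\<And>x. (\<Sum>p\<in>cell N. x p) = 0 \<Longrightarrow> (\<Sum>p\<in>cell N. \<Sum>q\<in>cell N. S p q * x q) = 0"
    by (rule diffusion_green_matrix[OF N h unit_face_periodic unit_face_positive]) (rule that)
  define A where "A = diffusion_matrix N ?h unit_face"
  define B where "B = (\<lambda>p q. - (3 / 4 * \<epsilon>\<^sup>2 * A p q) + \<sigma> / 2 * S p q + R p q / \<tau>)"
  define b where "b = (\<lambda>p. - \<theta>0 * (3 / 2 * at_node v p - 1 / 2 * at_node w p)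
     - 1 / 4 * \<epsilon>\<^sup>2 * at_node (diffusion ?h unit_face w) p
     + \<sigma> * (\<Sum>q\<in>cell N. S p q * (at_node v q / 2 - m)) - (\<Sum>q\<in>cell N. R p q * at_node v q) / \<tau>)"
  have vr: "at_node v p \<in> {-1<..<1}" if "p \<in> cell N" for p
    using that vn unfolding norm_inf_less_iff[OF N] by (auto simp: abs_less_iff)
  have "\<exists>x c. (\<forall>p\<in>cell N. \<bar>x p\<bar> < 1) \<and> (\<Sum>p\<in>cell N. x p) = real (card (cell N)) * m
     \<and> (\<forall>p\<in>cell N. site_potential \<tau> (at_node v p) (x p) + (\<Sum>q\<in>cell N. B p q * x q) + b p = c)"
  proof (rule constrained_critical_point)
    show "\<bar>m\<bar> < 1" using m by (simp add: m_def)
    show "B p q = B q p" if "p \<in> cell N" "q \<in> cell N" for p q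
      using Rsym[OF that] Ssym[OF that] diffusion_matrix_sym[OF unit_face_periodic that]
      by (simp add: B_def A_def)
    show "mono_on {-1<..<1} (site_potential \<tau> (at_node v p))" if "p \<in> cell N" for p
      by (rule strict_mono_on_imp_mono_on[OF site_potential_strict_mono[OF vr[OF that] \<tau>]])
  qed (use cell_nonempty[OF N] vr \<tau> in
      \<open>auto intro: site_potential_continuous site_potential_at_top site_potential_at_bot\<close>)
  then obtain x c where x1: "\<And>p. p \<in> cell N \<Longrightarrow> \<bar>x p\<bar> < 1" and xsum: "(\<Sum>p\<in>cell N. x p) = real N ^ 3 * m"
    and crit: "\<And>p. p \<in> cell N \<Longrightarrow> site_potential \<tau> (at_node v p) (x p) + (\<Sum>q\<in>cell N. B p q * x q) + b p = c"
    by auto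
  define \<phi> where "\<phi> = periodic_ext N x"
  have \<phi>V: "\<phi> \<in> V_per N" by (simp add: \<phi>_def)
  have \<phi>x: "at_node \<phi> p = x p" if "p \<in> cell N" for p using that by (simp add: \<phi>_def)
  have \<phi>m: "mean L N \<phi> = m" using N3 \<phi>x by (simp add: mean_eq[OF L N] xsum)
  have \<phi>n: "norm_inf N \<phi> < 1" unfolding norm_inf_less_iff[OF N] using \<phi>x x1 by simp
  let ?\<mu> = "mu_h L N \<theta>0 \<epsilon> \<sigma> \<tau> \<phi> v w"
  let ?g = "\<lambda>a b c. (\<phi> a b c + v a b c) / 2 - mean L N (\<lambda>a b c. (\<phi> a b c + v a b c) / 2)"
  define y where "y = (\<lambda>q. x q / 2 + (at_node v q / 2 - m))"
  have gV: "?g \<in> V_per N" by (intro V_per_arith V_per_const \<phi>V v)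
  have ysum: "(\<Sum>q\<in>cell N. y q) = 0"
    by (simp add: y_def sum.distrib sum_subtractf xsum vsum flip: sum_divide_distrib)
  have "mean L N (\<lambda>a b c. (\<phi> a b c + v a b c) / 2) = m"
    unfolding mean_midpoint[OF L N] \<phi>m by (simp add: m_def)
  then have gy: "?g = periodic_ext N y"
    by (intro V_per_eqI[OF N gV periodic_ext_V_per])
      (simp add: at_node_eqs \<phi>x y_def add_divide_distrib)
  \<comment> \<open>\<open>\<rho>\<close> is \<open>R (\<phi> - v)\<close>, and \<open>\<eta>\<close> is the nonlocal term of the chemical potential.\<close>
  define \<rho> where "\<rho> = periodic_ext N (\<lambda>p. \<Sum>q\<in>cell N. R p q * (x q - at_node v q))"
  define \<eta> where "\<eta> = periodic_ext N (\<lambda>p. \<Sum>q\<in>cell N. S p q * y q)"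
  have inv: "inv_neg_laplacian L N ?g = \<eta>"
  proof (rule inv_neg_laplacian_eqI[OF L N])
    show "\<eta> \<in> V0_per L N" using S0[OF ysum] by (simp add: V0_per_iff[OF L N] \<eta>_def)
    show "- laplacian ?h \<eta> i j k = ?g i j k" for i j k
      using S[OF ysum, of i j k] arg_cong[OF gy, of "\<lambda>f. f i j k"]
      by (simp add: laplacian_eq_diffusion \<eta>_def)
  qed
  have \<rho>eq: "- diffusion ?h a \<rho> i j k = \<phi> i j k - v i j k" for i j k
  proof -
    have e: "(\<lambda>i j k. \<phi> i j k - v i j k) = periodic_ext N (\<lambda>q. x q - at_node v q)"
      by (intro V_per_eqI[OF N] V_per_arith \<phi>V v periodic_ext_V_per) (simp add: at_node_eqs \<phi>x)
    have "(\<Sum>q\<in>cell N. x q - at_node v q) = 0" by (simp add: sum_subtractf xsum vsum)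
    from R[OF this, of i j k] arg_cong[OF e, of "\<lambda>f. f i j k"] show ?thesis by (simp add: \<rho>_def)
  qed
  have "?\<mu> = (\<lambda>i j k. c + (- 1 / \<tau>) * \<rho> i j k)"
  proof (rule V_per_eqI[OF N])
    show "?\<mu> \<in> V_per N" by (rule mu_h_V_per[OF L N \<phi>V v w])
    show "(\<lambda>i j k. c + (- 1 / \<tau>) * \<rho> i j k) \<in> V_per N"
      unfolding \<rho>_def by (intro V_per_arith V_per_const periodic_ext_V_per)
    fix p assume p: "p \<in> cell N"
    have lap: "at_node (diffusion ?h unit_face \<phi>) p = (\<Sum>q\<in>cell N. A p q * x q)"
      using diffusion_matrix_mult[OF N \<phi>V, of ?h unit_face p] \<phi>x by (simp add: A_def)
    have "(\<Sum>q\<in>cell N. B p q * x q) = (\<Sum>q\<in>cell N. - (3 / 4 * \<epsilon>\<^sup>2) * (A p q * x q)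
        + \<sigma> * (S p q * (x q / 2)) + 1 / \<tau> * (R p q * x q))"
      by (intro sum.cong refl) (simp add: B_def distrib_right left_diff_distrib)
    then have Bx: "(\<Sum>q\<in>cell N. B p q * x q) = - (3 / 4 * \<epsilon>\<^sup>2) * (\<Sum>q\<in>cell N. A p q * x q)
        + \<sigma> * (\<Sum>q\<in>cell N. S p q * (x q / 2)) + 1 / \<tau> * (\<Sum>q\<in>cell N. R p q * x q)"
      by (simp only: sum.distrib sum_distrib_left[symmetric])
    have \<eta>p: "at_node \<eta> p = (\<Sum>q\<in>cell N. S p q * (x q / 2)) + (\<Sum>q\<in>cell N. S p q * (at_node v q / 2 - m))"
      using p by (simp add: \<eta>_def y_def distrib_left sum.distrib)
    have \<rho>p: "at_node \<rho> p = (\<Sum>q\<in>cell N. R p q * x q) - (\<Sum>q\<in>cell N. R p q * at_node v q)"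
      using p by (simp add: \<rho>_def right_diff_distrib sum_subtractf)
    have "at_node ?\<mu> p = site_potential \<tau> (at_node v p) (x p)
        - \<theta>0 * (3 / 2 * at_node v p - 1 / 2 * at_node w p)
        - \<epsilon>\<^sup>2 * (3 / 4 * (\<Sum>q\<in>cell N. A p q * x q) + 1 / 4 * at_node (diffusion ?h unit_face w) p) + \<sigma> * at_node \<eta> p"
      using lap \<phi>x[OF p] inv by (cases p) (simp add: mu_h_eq)
    also have "\<dots> = c - at_node \<rho> p / \<tau>"
      unfolding crit[OF p, symmetric] Bx b_def \<eta>p \<rho>p diff_divide_distrib by (simp add: algebra_simps)
    finally show "at_node ?\<mu> p = at_node (\<lambda>i j k. c + (- 1 / \<tau>) * \<rho> i j k) p"
      by (cases p) simp
  qed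
  then have "diffusion ?h a ?\<mu> i j k = (\<phi> i j k - v i j k) / \<tau>" for i j k
    using \<rho>eq[of i j k] by (simp only: diffusion_linear diffusion_const) (simp add: field_simps)
  then show ?thesis using \<phi>V \<phi>n \<phi>m m_def by metis
qed

theorem theorem3p1:
  fixes L \<theta>0 \<epsilon> \<sigma> \<tau> M0 :: real and N :: nat
    and M :: "real \<Rightarrow> real"
    and \<phi>n \<phi>n1 :: grid
  assumes "L > 0" and "N \<ge> 1"
    and "\<theta>0 > 0" and "\<epsilon> > 0" and "\<sigma> \<ge> 0" and "\<tau> > 0"
    and "M0 > 0" and "\<And>x. x \<in> {-1..1} \<Longrightarrow> M x \<ge> M0"
    and "\<phi>n \<in> V_per N" and "\<phi>n1 \<in> V_per N"
    and "norm_inf N \<phi>n < 1" and "norm_inf N \<phi>n1 < 1"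
    and "\<bar>mean L N \<phi>n\<bar> = \<bar>mean L N \<phi>n1\<bar>" and "\<bar>mean L N \<phi>n\<bar> < 1"
  shows "\<exists>!\<phi>. \<phi> \<in> V_per N
    \<and> (\<forall>i j k. (\<phi> i j k - \<phi>n i j k) / \<tau> =
         divergence (spacing L N)
           (face_times (mobility_face M \<tau> \<phi>n \<phi>n1)
             (grad (spacing L N) (mu_h L N \<theta>0 \<epsilon> \<sigma> \<tau> \<phi> \<phi>n \<phi>n1))) i j k)
    \<and> (\<lambda>i j k. \<phi> i j k - mean L N \<phi>n) \<in> V0_per L N
    \<and> norm_inf N \<phi> < 1"
  unfolding diffusion_def[symmetric] minus_mean_V0_per_iff[OF assms(1,2)]
proof (rule ex_ex1I)
  let ?a = "mobility_face M \<tau> \<phi>n \<phi>n1"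
  have a: "face_periodic N ?a" "face_positive ?a"
    using assms by (simp_all add: mobility_face_periodic mobility_face_positive)
  show "\<exists>\<phi>. \<phi> \<in> V_per N
    \<and> (\<forall>i j k. (\<phi> i j k - \<phi>n i j k) / \<tau> =
         diffusion (spacing L N) ?a (mu_h L N \<theta>0 \<epsilon> \<sigma> \<tau> \<phi> \<phi>n \<phi>n1) i j k)
    \<and> (\<phi> \<in> V_per N \<and> mean L N \<phi> = mean L N \<phi>n) \<and> norm_inf N \<phi> < 1"
    using scheme_solution_exists[OF assms(1,2,6) a assms(9,10,11,14), of \<theta>0 \<epsilon> \<sigma>] by blast
  show "\<phi> = \<psi>"
    if "\<phi> \<in> V_per N
      \<and> (\<forall>i j k. (\<phi> i j k - \<phi>n i j k) / \<tau> =
           diffusion (spacing L N) ?a (mu_h L N \<theta>0 \<epsilon> \<sigma> \<tau> \<phi> \<phi>n \<phi>n1) i j k)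
      \<and> (\<phi> \<in> V_per N \<and> mean L N \<phi> = mean L N \<phi>n) \<and> norm_inf N \<phi> < 1"
      and "\<psi> \<in> V_per N
      \<and> (\<forall>i j k. (\<psi> i j k - \<phi>n i j k) / \<tau> =
           diffusion (spacing L N) ?a (mu_h L N \<theta>0 \<epsilon> \<sigma> \<tau> \<psi> \<phi>n \<phi>n1) i j k)
      \<and> (\<psi> \<in> V_per N \<and> mean L N \<psi> = mean L N \<phi>n) \<and> norm_inf N \<psi> < 1" for \<phi> \<psi>
    using that by (intro scheme_solution_unique[OF assms(1,2,5,6) a assms(9,10,11)]) auto
qed

end
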